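(* Let $\{\mathcal G_{\gamma,n}\}$ be the wavelet dictionary whose atoms are $g_n\left(\frac{x-u}{t}\right)e^{2\pi i\xi x}$, $n\in\mathbb N$, where $$g_n(x)=\sqrt{\tfrac{2n+1}{2t}}\,(1-|x|)^n\,\mathbf 1_{[-1,1]}(x).$$ Then $$\inf_{g_n\in\{\mathcal G_{\gamma,n}\}_{n\in\mathbb N}}U[g_n]=\min_{g_n\in\{\mathcal G_{\gamma,n}\}_{n\in\mathbb N}}U[g_n]=U[g_1]=\frac{3}{10},$$ where the minimum is attained by the function $$\operatorname*{argmin}_{g_n\in\{\mathcal G_{\gamma,n}\}_{n\in\mathbb N}}U[g_n]=g_1(x)=\sqrt{\tfrac{3}{2t}}\,(1-|x|)\,\mathbf 1_{[-1,1]}(x).$$ Moreover, $$\sup_{g_n\in\{\mathcal G_{\gamma,n}\}_{n\in\mathbb N}}U[g_n]=\frac12,$$ which is asymptotically attained by the Dirac delta function.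
   Context: Here $\mathbb N=\{0,1,2,\dots\}$ and $\gamma=(t,\xi,u)\in\Gamma=\mathbb R_{>0}\times\mathbb R^2$; explicitly, $\mathcal G_{\gamma,n}(x)=\sqrt{\frac{2n+1}{2t}}\left(1-\left|\frac{x-u}{t}\right|\right)^n\mathbf 1_{[u-t,u+t]}(x)\,e^{2\pi i\xi x}$, and $\mathbf 1_A$ is the indicator function of $A$. For a nonzero piecewise-polynomial function $f$ supported in a compact interval $K$, with $\|\cdot\|$ the $L^2$ norm and $\hat f(\omega)=\int_{\mathbb R}e^{-i\omega x}f(x)\,dx$, set $\alpha[f]=\frac1{\|f\|^2}\int_K x|f(x)|^2dx$, $\beta[\hat f]=\frac1{2\pi\|f\|^2}\int_{\mathbb R}\omega|\hat f(\omega)|^2d\omega$, $\sigma_x^2[f]=\frac1{\|f\|^2}\int_K(x-\alpha[f])^2|f(x)|^2dx$, $\sigma_\omega^2[\hat f]=\frac1{2\pi\|f\|^2}\int_{\mathbb R}(\omega-\beta[\hat f])^2|\hat f(\omega)|^2d\omega\in\mathbb R\cup\{+\infty\}$. The uncertainty is $U[f]=\sigma_x^2[f]\cdot\sigma_\omega^2[\hat f]\in\mathbb R\cup\{+\infty\}$.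
   Formalization: The supremum 1/2 is taken only over atoms of finite uncertainty, i.e. n ≥ 1: for n = 0 the atom is a modulated box with U = +∞, so the supremum over all n ∈ ℕ is +∞. Convergence to the Dirac delta is stated for atoms divided by their integral and for |atom|². *)

theory Defs
  imports "HOL-Analysis.Analysis"
begin

text \<open>
  For \<open>f\<close> vanishing outside a compact interval \<open>K\<close>, integrals over \<open>K\<close> and over the
  whole line agree, so no \<open>K\<close> appears in the definitions below.
\<close>

definition norm2 :: "(real \<Rightarrow> complex) \<Rightarrow> real" where
  "norm2 f = (LINT x|lborel. (cmod (f x))\<^sup>2)"

definition fourier :: "(real \<Rightarrow> complex) \<Rightarrow> real \<Rightarrow> complex" where
  "fourier f \<omega> = (LINT x|lborel. cis (- (\<omega> * x)) * f x)"

definition centre_x :: "(real \<Rightarrow> complex) \<Rightarrow> real" where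
  "centre_x f = (LINT x|lborel. x * (cmod (f x))\<^sup>2) / norm2 f"

text \<open>
  If \<open>\<omega> * (cmod (fourier f \<omega>))\<^sup>2\<close> is not integrable, \<open>centre_freq f\<close> is \<open>0\<close> by the
  convention of the Bochner integral.  For square-integrable \<open>f\<close>, \<open>var_freq f\<close> would then be
  infinite for every choice of the centre, so this convention does not affect it.
\<close>

definition centre_freq :: "(real \<Rightarrow> complex) \<Rightarrow> real" where
  "centre_freq f = (LINT \<omega>|lborel. \<omega> * (cmod (fourier f \<omega>))\<^sup>2) / (2 * pi * norm2 f)"

definition var_x :: "(real \<Rightarrow> complex) \<Rightarrow> ennreal" where
  "var_x f = (\<integral>\<^sup>+ x. ennreal ((x - centre_x f)\<^sup>2 * (cmod (f x))\<^sup>2) \<partial>lborel) / ennreal (norm2 f)"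

definition var_freq :: "(real \<Rightarrow> complex) \<Rightarrow> ennreal" where
  "var_freq f =
     (\<integral>\<^sup>+ \<omega>. ennreal ((\<omega> - centre_freq f)\<^sup>2 * (cmod (fourier f \<omega>))\<^sup>2) \<partial>lborel)
       / ennreal (2 * pi * norm2 f)"

definition uncertainty :: "(real \<Rightarrow> complex) \<Rightarrow> ennreal" where
  "uncertainty f = var_x f * var_freq f"

definition Gam :: "(real \<times> real \<times> real) set" where
  "Gam = {(t, \<xi>, u). 0 < t}"

definition profile :: "real \<Rightarrow> nat \<Rightarrow> real \<Rightarrow> real" where
  "profile t n x = sqrt ((2 * real n + 1) / (2 * t)) * (1 - \<bar>x\<bar>) ^ n * indicator {-1..1} x"

definition atom :: "real \<times> real \<times> real \<Rightarrow> nat \<Rightarrow> real \<Rightarrow> complex" where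
  "atom = (\<lambda>(t, \<xi>, u) n x. complex_of_real (profile t n ((x - u) / t)) * cis (2 * pi * \<xi> * x))"

definition dictionary :: "(real \<Rightarrow> complex) set" where
  "dictionary = {atom \<gamma> n | \<gamma> n. \<gamma> \<in> Gam}"

text \<open>
  Convergence to the Dirac delta at \<open>u\<close>, tested against all continuous functions.  This is meant
  for sequences with support in a common compact set, where every such integral exists.
\<close>

definition tends_to_dirac :: "(nat \<Rightarrow> real \<Rightarrow> complex) \<Rightarrow> real \<Rightarrow> bool" where
  "tends_to_dirac F u \<longleftrightarrow>
     (\<forall>\<phi> :: real \<Rightarrow> complex. continuous_on UNIV \<phi> \<longrightarrow>
        (\<lambda>n. LINT x|lborel. F n x * \<phi> x) \<longlonglongrightarrow> \<phi> u)"

end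

theory Submission
  imports Defs "HOL-Probability.Probability"
begin

text \<open>
  Up to translation, dilation, modulation and a constant factor, every atom is the profile
  \<open>h s = (1 - \<bar>s\<bar>)\<^sup>n\<close> on \<open>{-1..1}\<close>.  The position variance is a quotient of beta integrals.  For
  \<open>n \<ge> 1\<close> the profile is continuous and vanishes at the endpoints, so the transform of \<open>h'\<close> is
  \<open>\<i> * \<omega>\<close> times that of \<open>h\<close>, and Plancherel's identity, applied to \<open>h\<close> and to \<open>h'\<close>, gives
  the frequency variance as the ratio of the energies of \<open>h'\<close> and \<open>h\<close>.  The product of the
  two variances is
  \<open>U_bump n = n\<^sup>2 * (2 * n + 1) / ((2 * n - 1) * (n + 1) * (2 * n + 3))\<close>,
  which equals \<open>3 / 10\<close> at \<open>n = 1\<close>, lies strictly between \<open>3 / 10\<close> and \<open>1 / 2\<close> for \<open>n \<ge> 2\<close>, and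
  tends to \<open>1 / 2\<close>.  For \<open>n = 0\<close> the profile is a box, whose frequency variance is infinite.

  Plancherel's identity is needed for functions with jumps, since \<open>h'\<close> jumps at \<open>0\<close>.  It is proved in
  \<open>plancherel\<close> for bounded integrable functions that are continuous almost everywhere, by
  Gaussian summation of the transform of the autocorrelation.  The two statements about the Dirac
  delta follow from \<open>bump_approximate_identity\<close>: the profiles, normalised to integral \<open>1\<close>, have
  second moments tending to \<open>0\<close>.
\<close>

section \<open>The uncertainty as a function of the order\<close>

text \<open>
  The uncertainty of the atoms of order \<open>n \<ge> 1\<close>; it does not depend on scale, position,
  frequency or amplitude.
\<close>
definition U_bump :: "nat \<Rightarrow> real" where
  "U_bump n = (real n)\<^sup>2 * (2 * real n + 1) / ((2 * real n - 1) * (real n + 1) * (2 * real n + 3))"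

lemma U_bump_1: "U_bump 1 = 3 / 10"
  by (simp add: U_bump_def)

lemma U_bump_less_half:
  assumes "n \<ge> 1"
  shows "U_bump n < 1 / 2"
  unfolding U_bump_def
proof (rule mult_imp_div_pos_less)
  have "2 * real n - 1 > 0" "real n + 1 > 0" "2 * real n + 3 > 0" using assms by linarith+
  then show "0 < (2 * real n - 1) * (real n + 1) * (2 * real n + 3)" by simp
  have "(real n)\<^sup>2 \<ge> 1" using assms by simp
  then have "0 < 6 * (real n)\<^sup>2 + real n - 3" using assms by linarith
  also have "\<dots> = (2 * real n - 1) * (real n + 1) * (2 * real n + 3) - 2 * ((real n)\<^sup>2 * (2 * real n + 1))"
    by (simp add: algebra_simps power2_eq_square)
  finally show "(real n)\<^sup>2 * (2 * real n + 1) < 1 / 2 * ((2 * real n - 1) * (real n + 1) * (2 * real n + 3))"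
    by simp
qed

lemma U_bump_greater:
  assumes "n \<ge> 2"
  shows "U_bump n > 3 / 10"
proof -
  have "2 * real n - 1 > 0" "real n + 1 > 0" "2 * real n + 3 > 0" using assms by linarith+
  then have p: "(2 * real n - 1) * (real n + 1) * (2 * real n + 3) > 0" by simp
  have "10 * ((real n)\<^sup>2 * (2 * real n + 1)) - 3 * ((2 * real n - 1) * (real n + 1) * (2 * real n + 3))
    = (real n - 1) * (8 * real n * (real n - 2) + 10 * (real n - 2) + 11)"
    by (simp add: algebra_simps power2_eq_square power3_eq_cube)
  also have "\<dots> > 0" using assms by (intro mult_pos_pos add_nonneg_pos add_nonneg_nonneg) auto
  finally show ?thesis using p unfolding U_bump_def by (simp add: less_divide_eq)
qed

lemma U_bump_lim: "U_bump \<longlonglongrightarrow> 1 / 2"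
  unfolding U_bump_def[abs_def] by real_asymp

section \<open>The Fourier transform and the autocorrelation\<close>

lemma borel_measurable_cis [measurable]: "cis \<in> borel_measurable borel"
  by (intro borel_measurable_continuous_onI continuous_intros)

lemma borel_measurable_cnj [measurable]: "cnj \<in> borel_measurable borel"
  by (intro borel_measurable_continuous_onI continuous_intros)

lemma integrable_fourier_integrand:
  assumes "integrable lborel f"
  shows "integrable lborel (\<lambda>x. cis (- (\<omega> * x)) * f x)"
proof (rule Bochner_Integration.integrable_bound[OF assms])
  have [measurable]: "f \<in> borel_measurable borel"
    using borel_measurable_integrable[OF assms] by simp
  show "(\<lambda>x. cis (- (\<omega> * x)) * f x) \<in> borel_measurable lborel"
    by simp
qed (simp add: norm_mult)

lemma borel_measurable_fourier [measurable]:
  assumes [measurable]: "f \<in> borel_measurable borel"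
  shows "fourier f \<in> borel_measurable borel"
  unfolding fourier_def[abs_def] by measurable

lemma norm_fourier_le:
  assumes "integrable lborel f"
  shows "cmod (fourier f \<omega>) \<le> (LINT x|lborel. cmod (f x))"
proof -
  have "cmod (fourier f \<omega>) \<le> (LINT x|lborel. cmod (cis (- (\<omega> * x)) * f x))"
    unfolding fourier_def by (rule integral_norm_bound)
  then show ?thesis by (simp add: norm_mult)
qed

lemma fourier_cmult: "fourier (\<lambda>x. c * f x) \<omega> = c * fourier f \<omega>"
  unfolding fourier_def by (subst integral_mult_right_zero[symmetric]) (simp add: ac_simps)

text \<open>The multiplication formula, which moves the transform from one factor to the other.\<close>
lemma integral_mult_fourier:
  assumes a: "integrable lborel a" and w: "integrable lborel w"
  shows "(LINT \<omega>|lborel. w \<omega> * fourier a \<omega>) = (LINT s|lborel. a s * fourier w s)"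
proof -
  have [measurable]: "a \<in> borel_measurable borel" "w \<in> borel_measurable borel"
    using borel_measurable_integrable[OF a] borel_measurable_integrable[OF w] by simp_all
  let ?k = "\<lambda>\<omega> s. w \<omega> * (cis (- (\<omega> * s)) * a s)"
  have int: "integrable (lborel \<Otimes>\<^sub>M lborel) (case_prod ?k)"
  proof (rule lborel_pair.Fubini_integrable)
    show "integrable lborel (\<lambda>\<omega>. LINT s|lborel. cmod (case_prod ?k (\<omega>, s)))"
      using w by (simp add: norm_mult)
    show "AE \<omega> in lborel. integrable lborel (\<lambda>s. case_prod ?k (\<omega>, s))"
      using integrable_fourier_integrand[OF a] by simp
  qed measurable
  have "(LINT \<omega>|lborel. w \<omega> * fourier a \<omega>) = (LINT \<omega>|lborel. LINT s|lborel. ?k \<omega> s)"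
    unfolding fourier_def by simp
  also have "\<dots> = (LINT s|lborel. LINT \<omega>|lborel. ?k \<omega> s)"
    by (rule lborel_pair.Fubini_integral[OF int, symmetric])
  also have "\<dots> = (LINT s|lborel. a s * fourier w s)"
    unfolding fourier_def
    by (subst integral_mult_right_zero[symmetric]) (simp add: ac_simps)
  finally show ?thesis .
qed

text \<open>
  The autocorrelation of \<open>g\<close>.  It turns \<open>(cmod (fourier g \<omega>))\<^sup>2\<close> into a single Fourier
  transform, and its value at \<open>0\<close> is the energy of \<open>g\<close>.
\<close>
definition autocorr :: "(real \<Rightarrow> complex) \<Rightarrow> real \<Rightarrow> complex" where
  "autocorr g s = (LINT y|lborel. g (y + s) * cnj (g y))"

lemma autocorr_0: "autocorr g 0 = complex_of_real (norm2 g)"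
proof -
  have "autocorr g 0 = (LINT y|lborel. complex_of_real ((cmod (g y))\<^sup>2))"
    unfolding autocorr_def by (simp only: add_0_right complex_norm_square)
  then show ?thesis unfolding norm2_def by (simp only: integral_complex_of_real)
qed

lemma integrable_autocorr_pair:
  fixes g :: "real \<Rightarrow> complex"
  assumes g: "integrable lborel g"
  shows "integrable (lborel \<Otimes>\<^sub>M lborel) (\<lambda>(y, s). cis (- (\<omega> * s)) * (g (y + s) * cnj (g y)))"
    (is "integrable _ (case_prod ?k)")
proof (rule lborel_pair.Fubini_integrable)
  have [measurable]: "g \<in> borel_measurable borel"
    using borel_measurable_integrable[OF g] by simp
  have g': "integrable lborel (\<lambda>s. g (y + s))" for y
    using lborel_integrable_real_affine[OF g, of 1 y] by simp
  have "(LINT s|lborel. cmod (g (y + s))) = (LINT s|lborel. cmod (g s))" for y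
    using lborel_integral_real_affine[of 1 "\<lambda>s. cmod (g s)" y] by simp
  then have "(\<lambda>y. LINT s|lborel. cmod (case_prod ?k (y, s))) = (\<lambda>y. (LINT s|lborel. cmod (g s)) * cmod (g y))"
    by (simp add: norm_mult fun_eq_iff)
  then show "integrable lborel (\<lambda>y. LINT s|lborel. cmod (case_prod ?k (y, s)))"
    using g by simp
  show "AE y in lborel. integrable lborel (\<lambda>s. case_prod ?k (y, s))"
    using integrable_fourier_integrand[OF integrable_mult_left[OF g']] by simp
  show "case_prod ?k \<in> borel_measurable (lborel \<Otimes>\<^sub>M lborel)" by measurable
qed

lemma integrable_autocorr:
  assumes g: "integrable lborel g"
  shows "integrable lborel (autocorr g)"
  using lborel_pair.integrable_snd[OF integrable_autocorr_pair[OF g, of 0]]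
  unfolding autocorr_def[abs_def] by simp

lemma fourier_autocorr:
  assumes g: "integrable lborel g"
  shows "fourier (autocorr g) \<omega> = complex_of_real ((cmod (fourier g \<omega>))\<^sup>2)"
proof -
  have eq: "fourier g \<omega> = cis (- (\<omega> * y)) * (LINT s|lborel. cis (- (\<omega> * s)) * g (y + s))" for y
    using lborel_integral_real_affine[of 1 "\<lambda>x. cis (- (\<omega> * x)) * g x" y]
    unfolding fourier_def
    by (subst integral_mult_right_zero[symmetric]) (simp add: cis_mult algebra_simps)
  have "fourier (autocorr g) \<omega> =
      (LINT s|lborel. LINT y|lborel. cis (- (\<omega> * s)) * (g (y + s) * cnj (g y)))"
    unfolding fourier_def autocorr_def by simp
  also have "\<dots> = (LINT y|lborel. LINT s|lborel. cis (- (\<omega> * s)) * (g (y + s) * cnj (g y)))"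
    by (rule lborel_pair.Fubini_integral[OF integrable_autocorr_pair[OF g]])
  also have "\<dots> = (LINT y|lborel. cnj (cis (- (\<omega> * y)) * g y) * fourier g \<omega>)"
  proof (rule Bochner_Integration.integral_cong[OF refl])
    fix y
    have "(LINT s|lborel. cis (- (\<omega> * s)) * (g (y + s) * cnj (g y)))
        = cnj (g y) * (LINT s|lborel. cis (- (\<omega> * s)) * g (y + s))"
      by (subst integral_mult_right_zero[symmetric]) (simp add: ac_simps)
    also have "\<dots> = cnj (cis (- (\<omega> * y)) * g y) * fourier g \<omega>"
      unfolding eq[of y] by (simp add: cis_cnj mult.assoc mult.left_commute[of "cis (- (\<omega> * y))"] cis_mult flip: mult.assoc)
    finally show "(LINT s|lborel. cis (- (\<omega> * s)) * (g (y + s) * cnj (g y)))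
      = cnj (cis (- (\<omega> * y)) * g y) * fourier g \<omega>" .
  qed
  also have "\<dots> = cnj (fourier g \<omega>) * fourier g \<omega>"
    by (simp add: fourier_def del: complex_cnj_mult)
  also have "\<dots> = complex_of_real ((cmod (fourier g \<omega>))\<^sup>2)"
    by (simp only: complex_norm_square mult.commute)
  finally show ?thesis .
qed

lemma fourier_std_normal_density:
  assumes "\<delta> > 0"
  shows "fourier (\<lambda>\<omega>. complex_of_real (std_normal_density (\<delta> * \<omega>))) s
    = complex_of_real (sqrt (2 * pi) / \<delta> * std_normal_density (s / \<delta>))"
proof -
  have "complex_of_real (exp (- ((- s / \<delta>)\<^sup>2) / 2)) = char std_normal_distribution (- s / \<delta>)"
    by (simp add: char_std_normal_distribution)
  also have "\<dots> = (LINT z|lborel. std_normal_density z *\<^sub>R iexp (- s / \<delta> * z))"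
    unfolding char_def by (subst integral_density) (auto simp: normal_density_nonneg)
  also have "\<dots> = (LINT z|lborel. cis (- (s * (z / \<delta>))) * complex_of_real (std_normal_density z))"
    by (simp add: cis_conv_exp scaleR_conv_of_real mult.commute)
  also have "\<dots> = \<delta> *\<^sub>R (LINT w|lborel. cis (- (s * w)) * complex_of_real (std_normal_density (\<delta> * w)))"
    using lborel_integral_real_affine[of \<delta> "\<lambda>z. cis (- (s * (z / \<delta>))) * complex_of_real (std_normal_density z)" 0] assms
    by simp
  finally have "\<delta> *\<^sub>R fourier (\<lambda>\<omega>. complex_of_real (std_normal_density (\<delta> * \<omega>))) s
    = complex_of_real (exp (- ((s / \<delta>)\<^sup>2) / 2))"
    by (simp add: fourier_def)
  then show ?thesis using assms
    by (simp add: std_normal_density_def scaleR_conv_of_real field_simps)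
qed

section \<open>Plancherel's identity\<close>

lemma norm_autocorr_le:
  assumes g: "integrable lborel g" and B: "\<And>x. cmod (g x) \<le> B"
  shows "cmod (autocorr g s) \<le> B * (LINT y|lborel. cmod (g y))"
proof -
  have [measurable]: "g \<in> borel_measurable borel"
    using borel_measurable_integrable[OF g] by simp
  have le: "cmod (g (y + s) * cnj (g y)) \<le> B * cmod (g y)" for y
    by (simp add: norm_mult mult_right_mono B)
  have int: "integrable lborel (\<lambda>y. B * cmod (g y))"
    using g by simp
  have "cmod (autocorr g s) \<le> (LINT y|lborel. cmod (g (y + s) * cnj (g y)))"
    unfolding autocorr_def by (rule integral_norm_bound)
  also have "\<dots> \<le> (LINT y|lborel. B * cmod (g y))"
  proof (rule integral_mono[OF _ int le])
    show "integrable lborel (\<lambda>y. cmod (g (y + s) * cnj (g y)))"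
      by (rule Bochner_Integration.integrable_bound[OF int])
        (use le in \<open>auto intro: order_trans[OF _ abs_ge_self]\<close>)
  qed
  finally show ?thesis by simp
qed

text \<open>
  Continuity of \<open>g\<close> almost everywhere suffices for continuity of the autocorrelation at \<open>0\<close>;
  this covers functions with finitely many jumps.
\<close>
lemma autocorr_tendsto_0:
  assumes g: "integrable lborel g" and B: "\<And>x. cmod (g x) \<le> B"
    and cont: "AE x in lborel. isCont g x" and s: "s \<longlonglongrightarrow> 0"
  shows "(\<lambda>n. autocorr g (s n)) \<longlonglongrightarrow> autocorr g 0"
  unfolding autocorr_def
proof (rule integral_dominated_convergence[where w="\<lambda>y. B * cmod (g y)"])
  have [measurable]: "g \<in> borel_measurable borel"
    using borel_measurable_integrable[OF g] by simp
  show "(\<lambda>y. g (y + 0) * cnj (g y)) \<in> borel_measurable lborel"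
    "\<And>n. (\<lambda>y. g (y + s n) * cnj (g y)) \<in> borel_measurable lborel" by measurable
  show "integrable lborel (\<lambda>y. B * cmod (g y))" using g by simp
  show "AE y in lborel. (\<lambda>n. g (y + s n) * cnj (g y)) \<longlonglongrightarrow> g (y + 0) * cnj (g y)"
    using cont
  proof eventually_elim
    case (elim y)
    have "(\<lambda>n. y + s n) \<longlonglongrightarrow> y" using tendsto_add[OF tendsto_const s, of y] by simp
    then have "(\<lambda>n. g (y + s n)) \<longlonglongrightarrow> g y" by (rule isCont_tendsto_compose[OF elim])
    then show ?case by (auto intro!: tendsto_intros)
  qed
  show "AE y in lborel. cmod (g (y + s n) * cnj (g y)) \<le> B * cmod (g y)" for n
    by (simp add: norm_mult mult_right_mono B)
qed

text \<open>
  Plancherel's identity.  Both sides are first weighted by a Gaussian in \<open>\<omega>\<close> whose width tends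
  to infinity.  By the multiplication formula the weighted left-hand side is an average of the
  autocorrelation against a Gaussian concentrating at \<open>0\<close>, so it converges by dominated
  convergence, while the weights increase to a constant and monotone convergence applies.
\<close>
lemma plancherel:
  assumes g: "integrable lborel g" and B: "\<And>x. cmod (g x) \<le> B"
    and cont: "AE x in lborel. isCont g x"
  shows "(\<integral>\<^sup>+ \<omega>. ennreal ((cmod (fourier g \<omega>))\<^sup>2) \<partial>lborel) = ennreal (2 * pi * norm2 g)"
proof -
  have [measurable]: "g \<in> borel_measurable borel"
    using borel_measurable_integrable[OF g] by simp
  let ?A = "autocorr g" and ?p = std_normal_density
  define \<delta> :: "nat \<Rightarrow> real" where "\<delta> = (\<lambda>n. 1 / real (Suc n))"
  have \<delta>_pos: "\<delta> n > 0" for n by (simp add: \<delta>_def)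
  have \<delta>_lim: "\<delta> \<longlonglongrightarrow> 0" unfolding \<delta>_def by real_asymp
  have \<delta>_dec: "\<delta> n \<le> \<delta> m" if "m \<le> n" for m n
    using that by (simp add: \<delta>_def frac_le)
  have A[measurable]: "?A \<in> borel_measurable borel" and intA: "integrable lborel ?A"
    using integrable_autocorr[OF g] borel_measurable_integrable by auto
  define C where "C = B * (LINT y|lborel. cmod (g y))"
  have A_le: "cmod (?A s) \<le> C" for s
    unfolding C_def by (rule norm_autocorr_le[OF g B])
  have int_p: "integrable lborel (\<lambda>\<omega>. ?p (\<delta> n * \<omega>))" for n
    using lborel_integrable_real_affine[of ?p "\<delta> n" 0] \<delta>_pos[of n] by simp
  let ?F = "\<lambda>\<omega>. (cmod (fourier g \<omega>))\<^sup>2"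
  have F_le: "?F \<omega> \<le> (LINT x|lborel. cmod (g x))\<^sup>2" for \<omega>
    using norm_fourier_le[OF g] by (simp add: power_mono)
  have int_pF: "integrable lborel (\<lambda>\<omega>. ?p (\<delta> n * \<omega>) * ?F \<omega>)" for n
  proof (rule Bochner_Integration.integrable_bound)
    show "integrable lborel (\<lambda>\<omega>. ?p (\<delta> n * \<omega>) * (LINT x|lborel. cmod (g x))\<^sup>2)"
      using int_p by simp
    show "AE \<omega> in lborel. norm (?p (\<delta> n * \<omega>) * ?F \<omega>)
        \<le> norm (?p (\<delta> n * \<omega>) * (LINT x|lborel. cmod (g x))\<^sup>2)"
      using F_le by (simp add: abs_mult mult_left_mono)
  qed measurable
  have eq: "complex_of_real (LINT \<omega>|lborel. ?p (\<delta> n * \<omega>) * ?F \<omega>)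
      = sqrt (2 * pi) * (LINT z|lborel. ?A (\<delta> n * z) * ?p z)" for n
  proof -
    have "complex_of_real (LINT \<omega>|lborel. ?p (\<delta> n * \<omega>) * ?F \<omega>)
      = (LINT \<omega>|lborel. complex_of_real (?p (\<delta> n * \<omega>)) * fourier ?A \<omega>)"
      unfolding fourier_autocorr[OF g] of_real_mult[symmetric]
      by (rule integral_complex_of_real[symmetric])
    also have "\<dots> = (LINT s|lborel. ?A s * complex_of_real (sqrt (2 * pi) / \<delta> n * ?p (s / \<delta> n)))"
      using integral_mult_fourier[OF intA, of "\<lambda>\<omega>. complex_of_real (?p (\<delta> n * \<omega>))"]
      by (simp only: fourier_std_normal_density[OF \<delta>_pos] integrable_of_real[OF int_p])
    also have "\<dots> = \<delta> n *\<^sub>R (LINT z|lborel. ?A (\<delta> n * z) * complex_of_real (sqrt (2 * pi) / \<delta> n * ?p z))"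
      using lborel_integral_real_affine[of "\<delta> n"
        "\<lambda>s. ?A s * complex_of_real (sqrt (2 * pi) / \<delta> n * ?p (s / \<delta> n))" 0] \<delta>_pos[of n]
      by simp
    also have "\<dots> = (LINT z|lborel. sqrt (2 * pi) * (?A (\<delta> n * z) * ?p z))"
      using \<delta>_pos[of n]
      by (subst integral_scaleR_right[symmetric]) (simp add: scaleR_conv_of_real field_simps)
    finally show ?thesis by simp
  qed
  have "(\<lambda>n. LINT z|lborel. ?A (\<delta> n * z) * ?p z) \<longlonglongrightarrow> (LINT z|lborel. ?A 0 * complex_of_real (?p z))"
  proof (rule integral_dominated_convergence[where w="\<lambda>z. C * ?p z"])
    show "AE z in lborel. (\<lambda>n. ?A (\<delta> n * z) * ?p z) \<longlonglongrightarrow> ?A 0 * complex_of_real (?p z)"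
    proof (intro AE_I2 tendsto_intros autocorr_tendsto_0[OF g B cont])
      show "(\<lambda>n. \<delta> n * z) \<longlonglongrightarrow> 0" for z
        using tendsto_mult_left_zero[OF \<delta>_lim] .
    qed
    show "AE z in lborel. cmod (?A (\<delta> n * z) * ?p z) \<le> C * ?p z" for n
      by (simp add: norm_mult mult_right_mono A_le)
  qed simp_all
  also have "(LINT z|lborel. ?A 0 * complex_of_real (?p z)) = ?A 0"
    by simp
  finally have "(\<lambda>n. complex_of_real (LINT \<omega>|lborel. ?p (\<delta> n * \<omega>) * ?F \<omega>)) \<longlonglongrightarrow> sqrt (2 * pi) * ?A 0"
    unfolding eq by (intro tendsto_intros)
  then have lim: "(\<lambda>n. LINT \<omega>|lborel. ?p (\<delta> n * \<omega>) * ?F \<omega>) \<longlonglongrightarrow> sqrt (2 * pi) * norm2 g"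
    unfolding autocorr_0 of_real_mult[symmetric] by (rule tendsto_of_real_iff[THEN iffD1])
  have "(\<lambda>n. \<integral>\<^sup>+ \<omega>. ennreal (?p (\<delta> n * \<omega>) * ?F \<omega>) \<partial>lborel)
      \<longlonglongrightarrow> (\<integral>\<^sup>+ \<omega>. ennreal (1 / sqrt (2 * pi) * ?F \<omega>) \<partial>lborel)"
  proof (rule nn_integral_LIMSEQ)
    show "incseq (\<lambda>n \<omega>. ennreal (?p (\<delta> n * \<omega>) * ?F \<omega>))"
    proof (intro incseq_SucI le_funI ennreal_leI mult_right_mono)
      fix n \<omega>
      have "(\<delta> (Suc n) * \<omega>)\<^sup>2 \<le> (\<delta> n * \<omega>)\<^sup>2"
        unfolding power_mult_distrib using \<delta>_dec[of n "Suc n"] \<delta>_pos[of "Suc n"]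
        by (intro mult_right_mono power_mono) auto
      then show "?p (\<delta> n * \<omega>) \<le> ?p (\<delta> (Suc n) * \<omega>)"
        by (simp add: std_normal_density_def divide_right_mono)
    qed simp
    show "(\<lambda>n. ennreal (?p (\<delta> n * \<omega>) * ?F \<omega>)) \<longlonglongrightarrow> ennreal (1 / sqrt (2 * pi) * ?F \<omega>)" for \<omega>
    proof (intro tendsto_ennrealI tendsto_mult_right)
      have "(\<lambda>n. 1 / sqrt (2 * pi) * exp (- (\<delta> n * \<omega>)\<^sup>2 / 2)) \<longlonglongrightarrow> 1 / sqrt (2 * pi) * exp (- (0 * \<omega>)\<^sup>2 / 2)"
        by (intro tendsto_intros \<delta>_lim) simp
      then show "(\<lambda>n. ?p (\<delta> n * \<omega>)) \<longlonglongrightarrow> 1 / sqrt (2 * pi)"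
        by (simp add: std_normal_density_def)
    qed
  qed simp
  moreover have "(\<lambda>n. \<integral>\<^sup>+ \<omega>. ennreal (?p (\<delta> n * \<omega>) * ?F \<omega>) \<partial>lborel)
      \<longlonglongrightarrow> ennreal (sqrt (2 * pi) * norm2 g)"
    using tendsto_ennrealI[OF lim] by (simp add: nn_integral_eq_integral int_pF)
  ultimately have *: "(\<integral>\<^sup>+ \<omega>. ennreal (1 / sqrt (2 * pi) * ?F \<omega>) \<partial>lborel) = ennreal (sqrt (2 * pi) * norm2 g)"
    by (rule LIMSEQ_unique)
  have "(\<integral>\<^sup>+ \<omega>. ennreal (?F \<omega>) \<partial>lborel)
      = (\<integral>\<^sup>+ \<omega>. ennreal (sqrt (2 * pi)) * ennreal (1 / sqrt (2 * pi) * ?F \<omega>) \<partial>lborel)"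
    by (intro nn_integral_cong) (simp flip: ennreal_mult)
  also have "\<dots> = ennreal (sqrt (2 * pi)) * ennreal (sqrt (2 * pi) * norm2 g)"
    by (subst nn_integral_cmult) (simp, simp only: *)
  also have "\<dots> = ennreal (2 * pi * norm2 g)"
    by (simp add: norm2_def flip: ennreal_mult mult.assoc)
  finally show ?thesis .
qed

section \<open>Frequency moments of modulated real functions\<close>

lemma fourier_modulate:
  "fourier (\<lambda>x. f x * cis (\<eta> * x)) \<omega> = fourier f (\<omega> - \<eta>)"
  unfolding fourier_def
  by (intro Bochner_Integration.integral_cong refl) (simp add: cis_mult algebra_simps flip: mult.assoc)

lemma fourier_of_real_minus:
  "fourier (\<lambda>x. complex_of_real (h x)) (- \<omega>) = cnj (fourier (\<lambda>x. complex_of_real (h x)) \<omega>)"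
proof -
  have "fourier (\<lambda>x. complex_of_real (h x)) (- \<omega>)
      = (LINT x|lborel. cnj (cis (- (\<omega> * x)) * complex_of_real (h x)))"
    unfolding fourier_def by (simp add: cis_cnj)
  then show ?thesis unfolding fourier_def by (simp del: complex_cnj_mult)
qed

lemma norm2_modulate: "norm2 (\<lambda>x. f x * cis (\<eta> * x)) = norm2 f"
  by (simp add: norm2_def norm_mult)

text \<open>
  The transform of the derivative of a continuous, piecewise differentiable function on
  \<open>{a..b}\<close> that vanishes at both endpoints; \<open>S\<close> collects the points of non-differentiability.
\<close>
lemma fourier_derivative:
  fixes H K :: "real \<Rightarrow> real"
  assumes ab: "a \<le> b" and S: "finite S"
    and deriv: "\<And>x. x \<in> {a<..<b} - S \<Longrightarrow> (H has_real_derivative K x) (at x)"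
    and cont: "continuous_on {a..b} H" and zero: "H a = 0" "H b = 0"
    and h: "integrable lborel (\<lambda>x. H x * indicator {a..b} x)"
    and k: "integrable lborel (\<lambda>x. K x * indicator {a..b} x)"
  shows "fourier (\<lambda>x. complex_of_real (K x * indicator {a..b} x)) \<omega>
    = \<i> * \<omega> * fourier (\<lambda>x. complex_of_real (H x * indicator {a..b} x)) \<omega>"
proof -
  let ?h = "\<lambda>x. complex_of_real (H x * indicator {a..b} x)"
  let ?k = "\<lambda>x. complex_of_real (K x * indicator {a..b} x)"
  let ?E = "\<lambda>x. cis (- (\<omega> * x))"
  let ?D = "\<lambda>x. ?E x * complex_of_real (K x) - \<i> * \<omega> * (?E x * complex_of_real (H x))"
  have ih: "integrable lborel (\<lambda>x. ?E x * ?h x)" and ik: "integrable lborel (\<lambda>x. ?E x * ?k x)"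
    by (intro integrable_fourier_integrand integrable_of_real h k)+
  have "(?D has_integral (?E b * complex_of_real (H b) - ?E a * complex_of_real (H a))) {a..b}"
  proof (rule fundamental_theorem_of_calculus_interior_strong[OF S ab])
    fix x assume x: "x \<in> {a<..<b} - S"
    have 1: "((\<lambda>x. complex_of_real (H x)) has_vector_derivative complex_of_real (K x)) (at x)"
      using has_vector_derivative_of_real[OF deriv[OF x]] by simp
    have 2: "(?E has_vector_derivative - \<i> * \<omega> * ?E x) (at x)"
      unfolding cis_conv_exp
      by (auto intro!: derivative_eq_intros has_vector_derivative_real_field simp: mult_ac)
    show "((\<lambda>x. ?E x * complex_of_real (H x)) has_vector_derivative ?D x) (at x)"
      using has_vector_derivative_mult[OF 2 1] by (simp add: algebra_simps)
  qed (intro continuous_intros cont)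
  then have "(?D has_integral 0) {a..b}" by (simp add: zero)
  then have "((\<lambda>x. if x \<in> {a..b} then ?D x else 0) has_integral 0) UNIV"
    by (simp only: has_integral_restrict_UNIV)
  also have "(\<lambda>x. if x \<in> {a..b} then ?D x else 0) = (\<lambda>x. ?E x * ?k x - \<i> * \<omega> * (?E x * ?h x))"
    by (auto simp: fun_eq_iff)
  finally have "((\<lambda>x. ?E x * ?k x - \<i> * \<omega> * (?E x * ?h x)) has_integral 0) UNIV" .
  moreover have "((\<lambda>x. ?E x * ?k x - \<i> * \<omega> * (?E x * ?h x)) has_integral
      (LINT x|lborel. ?E x * ?k x - \<i> * \<omega> * (?E x * ?h x))) UNIV"
    by (intro has_integral_integral_lborel Bochner_Integration.integrable_diff integrable_mult_right ih ik)
  ultimately have "(LINT x|lborel. ?E x * ?k x - \<i> * \<omega> * (?E x * ?h x)) = 0"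
    by (rule has_integral_unique[rotated])
  then show ?thesis
    unfolding fourier_def
    by (subst (asm) Bochner_Integration.integral_diff[OF ik integrable_mult_right[OF ih]])
      (simp only: integral_mult_right_zero right_minus_eq)
qed

text \<open>
  For a real profile \<open>h\<close> modulated to the frequency \<open>\<eta>\<close>, the energy density of the transform is
  symmetric about \<open>\<eta>\<close>, so \<open>\<eta>\<close> is the frequency centre.  The frequency variance is then the
  ratio of the energies of \<open>h'\<close> and \<open>h\<close>; here \<open>k\<close> plays the role of \<open>h'\<close>.
\<close>
lemma
  fixes h :: "real \<Rightarrow> real" and k :: "real \<Rightarrow> complex" and \<eta> :: real
  defines "f \<equiv> (\<lambda>x. complex_of_real (h x) * cis (\<eta> * x))"
  assumes h: "integrable lborel h" "\<And>x. \<bar>h x\<bar> \<le> B" "AE x in lborel. isCont h x"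
    and k: "integrable lborel k" "\<And>x. cmod (k x) \<le> C" "AE x in lborel. isCont k x"
    and deriv: "\<And>\<omega>. fourier k \<omega> = \<i> * \<omega> * fourier (\<lambda>x. complex_of_real (h x)) \<omega>"
    and pos: "norm2 f > 0"
  shows centre_freq_modulated: "centre_freq f = \<eta>"
    and var_freq_modulated: "var_freq f = ennreal (norm2 k / norm2 f)"
proof -
  let ?h = "\<lambda>x. complex_of_real (h x)"
  define E where "E \<omega> = (cmod (fourier ?h \<omega>))\<^sup>2" for \<omega>
  have [measurable]: "h \<in> borel_measurable borel"
    using borel_measurable_integrable[OF h(1)] by simp
  have [measurable]: "E \<in> borel_measurable borel" unfolding E_def by measurable
  have n: "norm2 ?h = norm2 f" unfolding f_def norm2_modulate ..
  have contC: "AE x in lborel. isCont ?h x"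
    using h(3) by eventually_elim (rule continuous_of_real)
  have PE: "(\<integral>\<^sup>+ \<omega>. ennreal (E \<omega>) \<partial>lborel) = ennreal (2 * pi * norm2 f)"
    unfolding E_def n[symmetric]
    by (rule plancherel[of _ B]) (use h contC in \<open>auto\<close>)
  have PE2: "(\<integral>\<^sup>+ \<omega>. ennreal (\<omega>\<^sup>2 * E \<omega>) \<partial>lborel) = ennreal (2 * pi * norm2 k)"
    using plancherel[OF k] unfolding E_def deriv by (simp add: norm_mult power_mult_distrib)
  have iE: "integrable lborel E" and iE2: "integrable lborel (\<lambda>\<omega>. \<omega>\<^sup>2 * E \<omega>)"
    using PE PE2 by (auto intro!: integrableI_nonneg simp: E_def)
  have iE1: "integrable lborel (\<lambda>\<omega>. \<omega> * E \<omega>)"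
  proof (rule Bochner_Integration.integrable_bound[OF Bochner_Integration.integrable_add[OF iE iE2]])
    have "\<bar>\<omega>\<bar> \<le> 1 + \<omega>\<^sup>2" for \<omega> :: real
      using sum_squares_bound[of 1 "\<bar>\<omega>\<bar>"] by simp
    then have "\<bar>\<omega>\<bar> * E \<omega> \<le> (1 + \<omega>\<^sup>2) * E \<omega>" for \<omega>
      by (rule mult_right_mono) (simp add: E_def)
    then show "AE \<omega> in lborel. norm (\<omega> * E \<omega>) \<le> norm (E \<omega> + \<omega>\<^sup>2 * E \<omega>)"
      by (simp add: abs_mult E_def algebra_simps)
  qed simp
  have IE: "(LINT \<omega>|lborel. E \<omega>) = 2 * pi * norm2 f"
    using PE pos by (intro integral_eq_nn_integral[THEN trans]) (auto simp: E_def)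
  have even: "E (- \<omega>) = E \<omega>" for \<omega>
    unfolding E_def fourier_of_real_minus by simp
  have odd: "(LINT \<omega>|lborel. \<omega> * E \<omega>) = 0"
    using lborel_integral_real_affine[of "-1" "\<lambda>\<omega>. \<omega> * E \<omega>" 0] by (simp add: even)
  have F: "(cmod (fourier f \<omega>))\<^sup>2 = E (\<omega> - \<eta>)" for \<omega>
    unfolding f_def fourier_modulate E_def ..
  have "(LINT \<omega>|lborel. \<omega> * E (\<omega> - \<eta>)) = (LINT \<omega>|lborel. \<eta> * E \<omega> + \<omega> * E \<omega>)"
    using lborel_integral_real_affine[of 1 "\<lambda>\<omega>. \<omega> * E (\<omega> - \<eta>)" \<eta>]
    by (simp add: algebra_simps)
  also have "\<dots> = \<eta> * (2 * pi * norm2 f)"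
    using iE iE1 by (simp add: IE odd)
  finally show c: "centre_freq f = \<eta>"
    using pos unfolding centre_freq_def F by simp
  have "(\<integral>\<^sup>+ \<omega>. ennreal ((\<omega> - \<eta>)\<^sup>2 * E (\<omega> - \<eta>)) \<partial>lborel) = ennreal (2 * pi * norm2 k)"
    using nn_integral_real_affine[of "\<lambda>\<omega>. ennreal ((\<omega> - \<eta>)\<^sup>2 * E (\<omega> - \<eta>))" 1 \<eta>] PE2 by simp
  then show "var_freq f = ennreal (norm2 k / norm2 f)"
    unfolding var_freq_def F c using pos
    by (simp add: divide_ennreal norm2_def)
qed

section \<open>The power profiles and their moments\<close>

text \<open>
  The profile \<open>(1 - \<bar>s\<bar>)\<^sup>m\<close> cut off to \<open>{-1..1}\<close>, without normalisation.  By the convention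
  \<open>0 ^ 0 = 1\<close>, \<open>bump 0\<close> is the indicator function of \<open>{-1..1}\<close>.
\<close>
definition bump :: "nat \<Rightarrow> real \<Rightarrow> real" where
  "bump m s = (1 - \<bar>s\<bar>) ^ m * indicator {-1..1} s"

lemma bump_nonneg: "0 \<le> bump m s"
  by (auto simp: bump_def indicator_def)

lemma bump_le_1: "bump m s \<le> 1"
  by (auto simp: bump_def indicator_def intro!: power_le_one)

lemma bump_minus [simp]: "bump m (- s) = bump m s"
  by (auto simp: bump_def indicator_def)

lemma bump_square: "(bump m s)\<^sup>2 = bump (2 * m) s"
  by (simp add: bump_def indicator_def power_mult_distrib power_mult[symmetric] mult.commute)

lemma borel_measurable_bump [measurable]: "bump m \<in> borel_measurable borel"
  unfolding bump_def[abs_def] by measurable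

lemma isCont_bump: "s \<notin> {-1, 1} \<Longrightarrow> isCont (bump m) s"
  unfolding bump_def[abs_def]
  by (intro continuous_intros) (simp add: isCont_indicator frontier_cbox[of "-1::real" 1, unfolded cbox_interval box_real])

lemma has_bochner_integral_bump:
  "has_bochner_integral lborel (bump m) (2 / (real m + 1))"
proof -
  have "has_bochner_integral lborel (\<lambda>x::real. indicator {0..1} x *\<^sub>R (1 - x) ^ m)
     ((- ((1 - 1) ^ Suc m / (real m + 1))) - (- ((1 - 0) ^ Suc m / (real m + 1))))"
  proof (rule has_bochner_integral_FTC_Icc)
    fix x :: real
    show "((\<lambda>x. - ((1 - x) ^ Suc m / (real m + 1))) has_vector_derivative (1 - x) ^ m) (at x within {0..1})"
    proof -
      have "((\<lambda>x. 1 - x) has_real_derivative - 1) (at x within {0..1})"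
        by (auto intro!: derivative_eq_intros)
      from DERIV_minus[OF DERIV_cdivide[OF DERIV_power[OF this, of "Suc m"], of "real m + 1"]]
      show ?thesis
        by (simp add: add.commute del: power_Suc flip: has_real_derivative_iff_has_vector_derivative)
    qed
  qed (auto intro!: continuous_intros)
  moreover have "(\<lambda>x::real. indicator {0..1} x *\<^sub>R (1 - x) ^ m) = (\<lambda>x. indicator {0..} x *\<^sub>R bump m x)"
    by (auto simp: fun_eq_iff bump_def indicator_def)
  ultimately have "has_bochner_integral lborel (\<lambda>x. indicator {0..} x *\<^sub>R bump m x) (1 / (real m + 1))"
    by simp
  from has_bochner_integral_even_function[OF this] show ?thesis by simp
qed

lemma integrable_bump [simp]: "integrable lborel (bump m)"
  and integral_bump: "(LINT s|lborel. bump m s) = 2 / (real m + 1)"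
  using has_bochner_integral_bump[of m] by (auto simp: has_bochner_integral_iff)

text \<open>
  On the support, \<open>s\<^sup>2 = (1 - (1 - \<bar>s\<bar>))\<^sup>2\<close>; this reduces the second moment to the integrals of
  \<open>bump m\<close>, \<open>bump (m + 1)\<close> and \<open>bump (m + 2)\<close>.
\<close>
lemma has_bochner_integral_square_bump:
  "has_bochner_integral lborel (\<lambda>s. s\<^sup>2 * bump m s) (4 / ((real m + 1) * (real m + 2) * (real m + 3)))"
proof -
  have "s\<^sup>2 * bump m s = bump m s - 2 * bump (m + 1) s + bump (m + 2) s" for s
  proof -
    have "s\<^sup>2 = (1 - (1 - \<bar>s\<bar>))\<^sup>2" by simp
    then have "s\<^sup>2 = 1 - 2 * (1 - \<bar>s\<bar>) + (1 - \<bar>s\<bar>)\<^sup>2" by (simp only: power2_diff) simp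
    then show ?thesis by (simp only: bump_def power_add) (simp add: algebra_simps)
  qed
  moreover have "has_bochner_integral lborel (\<lambda>s. bump m s - 2 * bump (m + 1) s + bump (m + 2) s)
      (2 / (real m + 1) - 2 * (2 / (real (m + 1) + 1)) + 2 / (real (m + 2) + 1))"
    by (intro has_bochner_integral_add has_bochner_integral_diff has_bochner_integral_mult_right
        has_bochner_integral_bump)
  moreover have "2 / (real m + 1) - 2 * (2 / (real (m + 1) + 1)) + 2 / (real (m + 2) + 1)
      = 4 / ((real m + 1) * (real m + 2) * (real m + 3))"
  proof -
    have "real m + 1 \<noteq> 0" "real m + 2 \<noteq> 0" "real m + 3 \<noteq> 0" by linarith+
    then show ?thesis by (simp add: divide_simps add.commute) (simp add: algebra_simps)
  qed
  ultimately show ?thesis by simp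
qed

lemma integrable_mult_bump [simp]: "integrable lborel (\<lambda>s. s * bump m s)"
proof (rule Bochner_Integration.integrable_bound[OF integrable_bump])
  show "AE s in lborel. norm (s * bump m s) \<le> norm (bump m s)"
    by (auto simp: bump_def indicator_def abs_mult intro!: mult_left_le_one_le)
qed simp

lemma integral_mult_bump: "(LINT s|lborel. s * bump m s) = 0"
  using lborel_integral_real_affine[of "-1" "\<lambda>s. s * bump m s" 0] by simp

lemma integral_rescale:
  fixes f :: "real \<Rightarrow> 'a :: {banach, second_countable_topology}"
  assumes "t > 0"
  shows "(LINT x|lborel. f ((x - u) / t)) = t *\<^sub>R (LINT s|lborel. f s)"
  using lborel_integral_real_affine[of t "\<lambda>x. f ((x - u) / t)" u] assms by simp

lemma integrable_rescale:
  fixes f :: "real \<Rightarrow> 'a :: {banach, second_countable_topology}"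
  assumes "t > 0" "integrable lborel f"
  shows "integrable lborel (\<lambda>x. f ((x - u) / t))"
  using lborel_integrable_real_affine[OF assms(2), of "1 / t" "- u / t"] assms(1)
  by (simp add: field_simps)

lemma AE_isCont_bump_rescale:
  assumes "t > 0"
  shows "AE x in lborel. isCont (\<lambda>x. bump n ((x - u) / t)) x"
proof (rule AE_I')
  show "{u - t, u + t} \<in> null_sets lborel"
    by (intro finite_imp_null_set_lborel) simp
  have "isCont (\<lambda>x. bump n ((x - u) / t)) x" if "x \<notin> {u - t, u + t}" for x
  proof (rule isCont_o2[of _ "\<lambda>x. (x - u) / t"])
    show "isCont (\<lambda>x. (x - u) / t) x" using assms by (intro continuous_intros) auto
    show "isCont (bump n) ((x - u) / t)"
      using that assms by (intro isCont_bump) (auto simp: field_simps)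
  qed
  then show "{x \<in> space lborel. \<not> isCont (\<lambda>x. bump n ((x - u) / t)) x} \<subseteq> {u - t, u + t}"
    by blast
qed

text \<open>
  The general atom: amplitude \<open>c\<close>, scale \<open>t\<close>, position \<open>u\<close> and angular frequency \<open>\<eta>\<close>.  With the
  amplitude left free it covers the dictionary as well as rescaled copies of its elements.
\<close>
definition mod_bump :: "real \<Rightarrow> real \<Rightarrow> real \<Rightarrow> real \<Rightarrow> nat \<Rightarrow> real \<Rightarrow> complex" where
  "mod_bump c t u \<eta> n x = complex_of_real (c * bump n ((x - u) / t)) * cis (\<eta> * x)"

lemma norm_mod_bump: "(cmod (mod_bump c t u \<eta> n x))\<^sup>2 = c\<^sup>2 * bump (2 * n) ((x - u) / t)"
  by (simp add: mod_bump_def norm_mult power_mult_distrib bump_square flip: abs_mult)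

lemma norm2_mod_bump:
  assumes "t > 0"
  shows "norm2 (mod_bump c t u \<eta> n) = c\<^sup>2 * t * (2 / (2 * real n + 1))"
  unfolding norm2_def norm_mod_bump using integral_rescale[OF assms, of "bump (2 * n)" u]
  by (simp add: integral_bump)

lemma centre_x_mod_bump:
  assumes "t > 0" "c \<noteq> 0"
  shows "centre_x (mod_bump c t u \<eta> n) = u"
proof -
  have "(LINT x|lborel. x * (cmod (mod_bump c t u \<eta> n x))\<^sup>2)
      = (LINT x|lborel. (\<lambda>s. c\<^sup>2 * (u * bump (2 * n) s + t * (s * bump (2 * n) s))) ((x - u) / t))"
    using assms by (intro Bochner_Integration.integral_cong) (auto simp: norm_mod_bump field_simps)
  also have "\<dots> = t * (LINT s|lborel. c\<^sup>2 * (u * bump (2 * n) s + t * (s * bump (2 * n) s)))"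
    by (subst integral_rescale[OF assms(1)]) simp
  also have "\<dots> = t * (c\<^sup>2 * (u * (2 / (2 * real n + 1))))"
    by (simp add: integral_mult_bump integral_bump)
  finally show ?thesis using assms by (simp add: centre_x_def norm2_mod_bump)
qed

lemma var_x_mod_bump:
  assumes "t > 0" "c \<noteq> 0"
  shows "var_x (mod_bump c t u \<eta> n) = ennreal (t\<^sup>2 / ((real n + 1) * (2 * real n + 3)))"
proof -
  let ?g = "\<lambda>s. c\<^sup>2 * t\<^sup>2 * (s\<^sup>2 * bump (2 * n) s)"
  let ?I = "c\<^sup>2 * t\<^sup>2 * (4 / ((2 * real n + 1) * (2 * real n + 2) * (2 * real n + 3)))"
  have I: "has_bochner_integral lborel ?g ?I"
    using has_bochner_integral_mult_right[OF has_bochner_integral_square_bump[of "2 * n"]] by simp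
  have "(\<integral>\<^sup>+ x. ennreal ((x - u)\<^sup>2 * (cmod (mod_bump c t u \<eta> n x))\<^sup>2) \<partial>lborel)
      = (\<integral>\<^sup>+ x. ennreal (?g ((x - u) / t)) \<partial>lborel)"
    using assms by (intro nn_integral_cong) (auto simp: norm_mod_bump field_simps)
  also have "\<dots> = ennreal (LINT x|lborel. ?g ((x - u) / t))"
    using I assms
    by (intro nn_integral_eq_integral integrable_rescale) (auto simp: has_bochner_integral_iff bump_nonneg)
  also have "(LINT x|lborel. ?g ((x - u) / t)) = t * ?I"
    using I integral_rescale[OF assms(1), of ?g u] by (simp only: has_bochner_integral_iff real_scaleR_def)
  finally have "var_x (mod_bump c t u \<eta> n) = ennreal (t * ?I / (c\<^sup>2 * t * (2 / (2 * real n + 1))))"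
    unfolding var_x_def centre_x_mod_bump[OF assms] norm2_mod_bump[OF assms(1)]
    using assms by (simp only:) (intro divide_ennreal, auto)
  also have "t * ?I / (c\<^sup>2 * t * (2 / (2 * real n + 1))) = t\<^sup>2 / ((real n + 1) * (2 * real n + 3))"
  proof -
    have "2 * real n + 1 \<noteq> 0" "real n + 1 \<noteq> 0" "2 * real n + 3 \<noteq> 0" "2 * real n + 2 = 2 * (real n + 1)"
      by (linarith | simp)+
    then show ?thesis using assms by (simp only:) (simp add: divide_simps, simp add: algebra_simps)
  qed
  finally show ?thesis .
qed

text \<open>
  For \<open>n \<ge> 1\<close> the profile is continuous, and its derivative is, up to sign and a constant,
  \<open>bump (n - 1)\<close> at the same scale and position.  The derivative jumps at \<open>u\<close>,
  and for \<open>n = 1\<close> also at \<open>u - t\<close> and \<open>u + t\<close>.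
\<close>
lemma var_freq_mod_bump:
  assumes t: "t > 0" and c: "c \<noteq> 0" and n: "n \<ge> 1"
  shows "var_freq (mod_bump c t u \<eta> n) = ennreal ((real n)\<^sup>2 * (2 * real n + 1) / ((2 * real n - 1) * t\<^sup>2))"
proof -
  let ?f = "mod_bump c t u \<eta> n"
  define h where "h x = c * bump n ((x - u) / t)" for x
  \<comment> \<open>The sign of the slope of the profile; its value at \<open>u\<close> is chosen so that its modulus is \<open>1\<close> everywhere.\<close>
  define \<sigma> where "\<sigma> x = (if u \<le> x then - 1 else 1 :: real)" for x
  define k where "k x = c * real n / t * \<sigma> x * bump (n - 1) ((x - u) / t)" for x
  have [measurable]: "\<sigma> \<in> borel_measurable borel" unfolding \<sigma>_def[abs_def] by measurable
  have f: "?f = (\<lambda>x. complex_of_real (h x) * cis (\<eta> * x))"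
    by (simp add: mod_bump_def h_def fun_eq_iff)
  have abs_\<sigma>: "\<bar>\<sigma> x\<bar> = 1" for x by (simp add: \<sigma>_def)
  have abs_k: "\<bar>k x\<bar> = \<bar>c * real n / t\<bar> * bump (n - 1) ((x - u) / t)" for x
    unfolding k_def abs_mult abs_\<sigma> by (simp add: bump_nonneg)
  have int_h: "integrable lborel h"
    unfolding h_def[abs_def] by (intro integrable_mult_right integrable_rescale t integrable_bump)
  have int_k: "integrable lborel k"
  proof (rule Bochner_Integration.integrable_bound)
    show "integrable lborel (\<lambda>x. \<bar>c * real n / t\<bar> * bump (n - 1) ((x - u) / t))"
      by (intro integrable_mult_right integrable_rescale t integrable_bump)
    show "k \<in> borel_measurable lborel" unfolding k_def[abs_def] by measurable
  qed (simp add: abs_k bump_nonneg)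
  have cont_h: "AE x in lborel. isCont h x"
    using AE_isCont_bump_rescale[OF t, of n u] unfolding h_def[abs_def]
    by eventually_elim (intro continuous_intros)
  have cont_k: "AE x in lborel. isCont (\<lambda>x. complex_of_real (k x)) x"
    using AE_isCont_bump_rescale[OF t, of "n - 1" u] AE_lborel_singleton[of u]
  proof eventually_elim
    case (elim x)
    have "\<forall>\<^sub>F y in nhds x. \<sigma> y = \<sigma> x"
    proof (cases "x < u")
      case True
      then have "\<forall>\<^sub>F y in nhds x. y < u" using eventually_nhds_in_open[of "{..<u}" x] by simp
      then show ?thesis by eventually_elim (use True in \<open>simp add: \<sigma>_def\<close>)
    next
      case False
      then have "u < x" using elim by simp
      then have "\<forall>\<^sub>F y in nhds x. u < y" using eventually_nhds_in_open[of "{u<..}" x] by simp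
      then show ?thesis by eventually_elim (use \<open>u < x\<close> in \<open>simp add: \<sigma>_def\<close>)
    qed
    then have "isCont \<sigma> x \<longleftrightarrow> isCont (\<lambda>_. \<sigma> x) x" by (rule isCont_cong)
    then have "isCont \<sigma> x" by simp
    then show ?case unfolding k_def by (intro continuous_intros elim) (use t in auto)
  qed
  have deriv: "fourier (\<lambda>x. complex_of_real (k x)) \<omega> = \<i> * \<omega> * fourier (\<lambda>x. complex_of_real (h x)) \<omega>" for \<omega>
  proof -
    let ?H = "\<lambda>x. c * (1 - \<bar>(x - u) / t\<bar>) ^ n"
    let ?K = "\<lambda>x. c * real n / t * \<sigma> x * (1 - \<bar>(x - u) / t\<bar>) ^ (n - 1)"
    have ind: "indicator {-1..1} ((x - u) / t) = (indicator {u - t..u + t} x :: real)" for x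
      using t by (auto simp: indicator_def field_simps)
    have h': "h = (\<lambda>x. ?H x * indicator {u - t..u + t} x)" and k': "k = (\<lambda>x. ?K x * indicator {u - t..u + t} x)"
      by (simp_all add: fun_eq_iff h_def k_def bump_def ind)
    show ?thesis unfolding h' k'
    proof (rule fourier_derivative[where S="{u}"])
      fix x assume x: "x \<in> {u - t<..<u + t} - {u}"
      have "(\<lambda>x. 1 - \<bar>(x - u) / t\<bar>) = (\<lambda>x. 1 - \<bar>x - u\<bar> / t)" using t by (simp add: fun_eq_iff)
      moreover have "((\<lambda>x. 1 - \<bar>x - u\<bar> / t) has_real_derivative \<sigma> x / t) (at x)"
      proof (cases "u < x")
        case True
        show ?thesis
          by (rule has_field_derivative_transform_within_open[of "\<lambda>x. 1 - (x - u) / t" _ _ "{u<..}"])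
            (use True t in \<open>auto intro!: derivative_eq_intros simp: \<sigma>_def\<close>)
      next
        case False
        then have "x < u" using x by auto
        show ?thesis
          by (rule has_field_derivative_transform_within_open[of "\<lambda>x. 1 - (u - x) / t" _ _ "{..<u}"])
            (use \<open>x < u\<close> t in \<open>auto intro!: derivative_eq_intros simp: \<sigma>_def\<close>)
      qed
      ultimately have "((\<lambda>x. 1 - \<bar>(x - u) / t\<bar>) has_real_derivative \<sigma> x / t) (at x)" by simp
      from DERIV_cmult[OF DERIV_power[OF this, of n], of c]
      show "(?H has_real_derivative ?K x) (at x)" by (simp add: mult_ac)
    next
      show "continuous_on {u - t..u + t} ?H" using t by (intro continuous_intros) auto
    qed (use t n int_h int_k in \<open>auto simp: h' k'\<close>)
  qed
  have pos: "norm2 ?f > 0" using t c by (simp add: norm2_mod_bump)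
  have "norm2 (\<lambda>x. complex_of_real (k x)) = (LINT x|lborel. (c * real n / t)\<^sup>2 * bump (2 * (n - 1)) ((x - u) / t))"
    by (simp only: norm2_def norm_of_real abs_k power_mult_distrib bump_square power2_abs)
  also have "\<dots> = (c * real n / t)\<^sup>2 * (t * (2 / (2 * real n - 1)))"
    using n integral_rescale[OF t, of "bump (2 * (n - 1))" u] by (simp add: integral_bump of_nat_diff algebra_simps)
  finally have nk: "norm2 (\<lambda>x. complex_of_real (k x)) = (c * real n / t)\<^sup>2 * (t * (2 / (2 * real n - 1)))" .
  have "var_freq ?f = ennreal (norm2 (\<lambda>x. complex_of_real (k x)) / norm2 ?f)"
    unfolding f
  proof (rule var_freq_modulated[where B="\<bar>c\<bar>" and C="\<bar>c * real n / t\<bar>"])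
    show "\<bar>h x\<bar> \<le> \<bar>c\<bar>" for x
      using bump_nonneg[of n] bump_le_1[of n] by (simp add: h_def abs_mult mult_left_le)
    show "cmod (complex_of_real (k x)) \<le> \<bar>c * real n / t\<bar>" for x
      unfolding norm_of_real abs_k by (intro mult_left_le bump_le_1 abs_ge_zero)
    show "0 < norm2 (\<lambda>x. complex_of_real (h x) * cis (\<eta> * x))" using pos unfolding f .
  qed (use int_h int_k cont_h cont_k deriv in simp_all)
  also have "norm2 (\<lambda>x. complex_of_real (k x)) / norm2 ?f
      = (real n)\<^sup>2 * (2 * real n + 1) / ((2 * real n - 1) * t\<^sup>2)"
  proof -
    have "2 * real n - 1 \<noteq> 0" "2 * real n + 1 \<noteq> 0" using n by linarith+
    then show ?thesis using t c unfolding nk norm2_mod_bump[OF t] by (simp add: field_simps power2_eq_square)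
  qed
  finally show ?thesis .
qed

section \<open>The box profile and the uncertainty of the general atom\<close>

lemma norm_fourier_box:
  assumes t: "t > 0" and v: "v \<noteq> 0"
  shows "(cmod (fourier (\<lambda>x. complex_of_real (bump 0 ((x - u) / t))) v))\<^sup>2 = 2 * (1 - cos (2 * t * v)) / v\<^sup>2"
proof -
  let ?G = "\<lambda>x. \<i> / v * cis (- (v * x))"
  have "has_bochner_integral lborel (\<lambda>x. indicator {u - t..u + t} x *\<^sub>R cis (- (v * x))) (?G (u + t) - ?G (u - t))"
  proof (rule has_bochner_integral_FTC_Icc)
    fix x
    have "((\<lambda>x. cis (- (v * x))) has_vector_derivative - \<i> * v * cis (- (v * x))) (at x within {u - t..u + t})"
      unfolding cis_conv_exp
      by (auto intro!: derivative_eq_intros has_vector_derivative_real_field simp: mult_ac)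
    from has_vector_derivative_mult_right[OF this, of "\<i> / v"]
    show "(?G has_vector_derivative cis (- (v * x))) (at x within {u - t..u + t})"
      using v by (simp add: field_simps)
  qed (use t in \<open>auto intro!: continuous_intros\<close>)
  moreover have "(\<lambda>x. indicator {u - t..u + t} x *\<^sub>R cis (- (v * x)))
      = (\<lambda>x. cis (- (v * x)) * complex_of_real (bump 0 ((x - u) / t)))"
    using t by (auto simp: fun_eq_iff bump_def indicator_def field_simps)
  ultimately have "fourier (\<lambda>x. complex_of_real (bump 0 ((x - u) / t))) v = ?G (u + t) - ?G (u - t)"
    unfolding fourier_def by (simp add: has_bochner_integral_iff)
  also have "cis (- (v * (u + t))) = cis (- (v * u)) * cis (- (v * t))"
    by (simp add: cis_mult algebra_simps)
  also have "cis (- (v * (u - t))) = cis (- (v * u)) * cis (v * t)"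
    by (simp add: cis_mult algebra_simps)
  also have "\<i> / v * (cis (- (v * u)) * cis (- (v * t))) - \<i> / v * (cis (- (v * u)) * cis (v * t))
      = \<i> / v * cis (- (v * u)) * (cis (- (v * t)) - cis (v * t))"
    by (simp add: right_diff_distrib mult.assoc)
  also have "cis (- (v * t)) - cis (v * t) = - 2 * \<i> * sin (v * t)"
    by (simp add: complex_eq_iff)
  finally have "cmod (fourier (\<lambda>x. complex_of_real (bump 0 ((x - u) / t))) v) = 2 * \<bar>sin (v * t)\<bar> / \<bar>v\<bar>"
    by (simp add: norm_mult norm_divide)
  moreover have "2 * t * v = 2 * (v * t)" by simp
  ultimately show ?thesis
    by (simp only: cos_double_sin) (simp add: power_mult_distrib power_divide)
qed

lemma nn_integral_one_minus_cos:
  assumes "a > 0" "R \<ge> 0"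
  shows "(\<integral>\<^sup>+ v. ennreal (1 - cos (a * v)) * indicator {N..N + R} v \<partial>lborel) \<ge> ennreal (R - 2 / a)"
proof -
  have "(\<integral>\<^sup>+ v. ennreal (1 - cos (a * v)) * indicator {N..N + R} v \<partial>lborel)
      = ennreal ((N + R - sin (a * (N + R)) / a) - (N - sin (a * N) / a))"
    by (rule nn_integral_FTC_Icc) (use assms in \<open>auto intro!: derivative_eq_intros\<close>)
  also have "\<dots> \<ge> ennreal (R - 2 / a)"
  proof (rule ennreal_leI)
    have "(sin (a * (N + R)) - sin (a * N)) / a \<le> 2 / a"
      using assms sin_le_one[of "a * (N + R)"] sin_ge_minus_one[of "a * N"]
      by (intro divide_right_mono) linarith+
    then show "R - 2 / a \<le> (N + R - sin (a * (N + R)) / a) - (N - sin (a * N) / a)"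
      by (simp add: diff_divide_distrib)
  qed
  finally show ?thesis .
qed

text \<open>
  For \<open>n = 0\<close> the profile jumps at the ends of its support: its energy density decays only like
  \<open>(1 - cos (2 * t * v)) / v\<^sup>2\<close>, so the variance about any centre diverges.
\<close>
lemma var_freq_mod_bump_0:
  assumes t: "t > 0" and c: "c \<noteq> 0"
  shows "var_freq (mod_bump c t u \<eta> 0) = \<infinity>"
proof -
  let ?f = "mod_bump c t u \<eta> 0"
  define b where "b = \<eta> - centre_freq ?f"
  \<comment> \<open>From \<open>N\<close> on, \<open>b + v \<ge> v / 2\<close>, so the weight \<open>(b + v)\<^sup>2\<close> compensates the decay.\<close>
  define N where "N = 2 * \<bar>b\<bar> + 1"
  let ?X = "\<integral>\<^sup>+ \<omega>. ennreal ((\<omega> - centre_freq ?f)\<^sup>2 * (cmod (fourier ?f \<omega>))\<^sup>2) \<partial>lborel"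
  have f: "?f = (\<lambda>x. c * complex_of_real (bump 0 ((x - u) / t)) * cis (\<eta> * x))"
    by (simp add: mod_bump_def fun_eq_iff)
  have [measurable]: "?f \<in> borel_measurable borel"
    unfolding f by measurable
  have F: "(cmod (fourier ?f (\<eta> + v)))\<^sup>2 = c\<^sup>2 * (2 * (1 - cos (2 * t * v)) / v\<^sup>2)" if "v \<noteq> 0" for v
    unfolding f fourier_modulate fourier_cmult
    using norm_fourier_box[OF t that, of u] by (simp add: norm_mult power_mult_distrib)
  have le: "ennreal r \<le> ?X" for r
  proof -
    \<comment> \<open>The length at which the bound of \<open>nn_integral_one_minus_cos\<close>, times \<open>c\<^sup>2 / 2\<close>, reaches \<open>r\<close>.\<close>
    define R where "R = max 0 (1 / t + 2 * r / c\<^sup>2)"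
    have pw: "ennreal (c\<^sup>2 / 2) * (ennreal (1 - cos (2 * t * v)) * indicator {N..N + R} v)
        \<le> ennreal ((\<eta> + v - centre_freq ?f)\<^sup>2 * (cmod (fourier ?f (\<eta> + v)))\<^sup>2)" for v
    proof (cases "v \<in> {N..N + R}")
      case True
      then have v: "v \<ge> 2 * \<bar>b\<bar> + 1" by (simp add: N_def)
      then have "v > 0" "v / 2 \<le> b + v" by linarith+
      then have "(v / 2)\<^sup>2 \<le> (b + v)\<^sup>2" by (intro power_mono) auto
      then have "(v / 2)\<^sup>2 * (c\<^sup>2 * (2 * (1 - cos (2 * t * v)) / v\<^sup>2))
          \<le> (b + v)\<^sup>2 * (c\<^sup>2 * (2 * (1 - cos (2 * t * v)) / v\<^sup>2))"
        by (rule mult_right_mono) simp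
      also have "(v / 2)\<^sup>2 * (c\<^sup>2 * (2 * (1 - cos (2 * t * v)) / v\<^sup>2)) = c\<^sup>2 / 2 * (1 - cos (2 * t * v))"
        using \<open>v > 0\<close> by (simp add: power_divide)
      also have "c\<^sup>2 * (2 * (1 - cos (2 * t * v)) / v\<^sup>2) = (cmod (fourier ?f (\<eta> + v)))\<^sup>2"
        using F[of v] \<open>v > 0\<close> by simp
      also have "b + v = \<eta> + v - centre_freq ?f" by (simp add: b_def)
      finally have "c\<^sup>2 / 2 * (1 - cos (2 * t * v))
          \<le> (\<eta> + v - centre_freq ?f)\<^sup>2 * (cmod (fourier ?f (\<eta> + v)))\<^sup>2" .
      then show ?thesis using True by (simp add: ennreal_leI flip: ennreal_mult)
    qed simp
    have "r \<le> c\<^sup>2 / 2 * (R - 2 / (2 * t))"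
      using c t by (simp add: R_def field_simps max_def)
    then have "ennreal r \<le> ennreal (c\<^sup>2 / 2 * (R - 2 / (2 * t)))"
      by (rule ennreal_leI)
    also have "\<dots> = ennreal (c\<^sup>2 / 2) * ennreal (R - 2 / (2 * t))"
      by (rule ennreal_mult') simp
    also have "\<dots> \<le> ennreal (c\<^sup>2 / 2) * (\<integral>\<^sup>+ v. ennreal (1 - cos (2 * t * v)) * indicator {N..N + R} v \<partial>lborel)"
      by (intro mult_left_mono nn_integral_one_minus_cos) (use t in \<open>simp_all add: R_def\<close>)
    also have "\<dots> = (\<integral>\<^sup>+ v. ennreal (c\<^sup>2 / 2) * (ennreal (1 - cos (2 * t * v)) * indicator {N..N + R} v) \<partial>lborel)"
      by (rule nn_integral_cmult[symmetric]) simp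
    also have "\<dots> \<le> (\<integral>\<^sup>+ v. ennreal ((\<eta> + v - centre_freq ?f)\<^sup>2 * (cmod (fourier ?f (\<eta> + v)))\<^sup>2) \<partial>lborel)"
      by (intro nn_integral_mono pw)
    also have "\<dots> = ?X"
      using nn_integral_real_affine[of "\<lambda>\<omega>. ennreal ((\<omega> - centre_freq ?f)\<^sup>2 * (cmod (fourier ?f \<omega>))\<^sup>2)" 1 \<eta>]
      by simp
    finally show ?thesis .
  qed
  have "?X = \<infinity>"
  proof (cases ?X)
    case (real r)
    then show ?thesis using le[of "r + 1"] by (simp add: ennreal_le_iff)
  qed simp
  then show ?thesis
    unfolding var_freq_def by (simp add: ennreal_top_divide)
qed

lemma uncertainty_mod_bump:
  assumes t: "t > 0" and c: "c \<noteq> 0"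
  shows "uncertainty (mod_bump c t u \<eta> n) = (if n = 0 then \<infinity> else ennreal (U_bump n))"
proof (cases "n = 0")
  case True
  then show ?thesis using assms
    by (simp add: uncertainty_def var_freq_mod_bump_0 var_x_mod_bump ennreal_mult_top)
next
  case False
  then have "n \<ge> 1" by simp
  then have "2 * real n - 1 > 0" by linarith
  then show ?thesis using assms False
    by (simp add: uncertainty_def var_freq_mod_bump var_x_mod_bump U_bump_def ac_simps flip: ennreal_mult)
qed

section \<open>Convergence to the Dirac delta\<close>

lemma integrable_bump_mult:
  fixes \<psi> :: "real \<Rightarrow> complex"
  assumes "continuous_on UNIV \<psi>"
  shows "integrable lborel (\<lambda>s. complex_of_real (bump m s) * \<psi> s)"
proof -
  have "compact (\<psi> ` {-1..1})"
    by (intro compact_continuous_image continuous_on_subset[OF assms]) auto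
  from compact_imp_bounded[OF this] obtain B where "\<forall>s\<in>{-1..1}. cmod (\<psi> s) \<le> B"
    by (auto simp: bounded_iff)
  note B = this[rule_format]
  have [measurable]: "\<psi> \<in> borel_measurable borel"
    by (rule borel_measurable_continuous_onI[OF assms])
  show ?thesis
  proof (rule Bochner_Integration.integrable_bound)
    show "integrable lborel (\<lambda>s. B * bump m s)" by simp
    have "bump m s * cmod (\<psi> s) \<le> B * bump m s" for s
    proof (cases "s \<in> {-1..1}")
      case True
      then show ?thesis using mult_left_mono[OF B[OF True] bump_nonneg[of m s]] by (simp add: mult.commute)
    qed (auto simp: bump_def)
    then show "AE s in lborel. norm (complex_of_real (bump m s) * \<psi> s) \<le> norm (B * bump m s)"
      by (auto simp: norm_mult bump_nonneg intro: order_trans[OF _ abs_ge_self])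
  qed measurable
qed

text \<open>
  The normalised profiles form an approximate identity.  By continuity at \<open>0\<close> and boundedness
  on the support, \<open>cmod (\<psi> s - \<psi> 0) \<le> \<epsilon> / 2 + K * s\<^sup>2\<close>, and the second moment of the normalised
  profile tends to \<open>0\<close>.
\<close>
lemma bump_approximate_identity:
  fixes \<psi> :: "real \<Rightarrow> complex"
  assumes cont: "continuous_on UNIV \<psi>"
  shows "(\<lambda>m. complex_of_real ((real m + 1) / 2) * (LINT s|lborel. complex_of_real (bump m s) * \<psi> s)) \<longlonglongrightarrow> \<psi> 0"
proof (rule tendstoI)
  fix \<epsilon> :: real assume \<epsilon>: "\<epsilon> > 0"
  let ?d = "\<lambda>s. \<psi> s - \<psi> 0"
  have contd: "continuous_on UNIV ?d" by (intro continuous_intros cont)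
  have "compact (?d ` {-1..1})"
    by (intro compact_continuous_image continuous_on_subset[OF contd]) auto
  from compact_imp_bounded[OF this] obtain B where "\<forall>s\<in>{-1..1}. cmod (?d s) \<le> B"
    by (auto simp: bounded_iff)
  note B = this[rule_format]
  have "0 \<le> B" using B[of 0] by simp
  obtain \<delta> where \<delta>: "\<delta> > 0" "\<And>s. \<bar>s\<bar> < \<delta> \<Longrightarrow> cmod (?d s) < \<epsilon> / 2"
    using cont[unfolded continuous_on_iff, rule_format, of 0 "\<epsilon> / 2"] \<epsilon> by (auto simp: dist_norm)
  define K where "K = B / \<delta>\<^sup>2"
  have "K \<ge> 0" using \<open>0 \<le> B\<close> by (simp add: K_def)
  \<comment> \<open>Away from \<open>0\<close> the quadratic term alone is at least \<open>B\<close>.\<close>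
  have d: "cmod (?d s) \<le> \<epsilon> / 2 + K * s\<^sup>2" if "s \<in> {-1..1}" for s
  proof (cases "\<bar>s\<bar> < \<delta>")
    case True
    then show ?thesis using \<delta>(2)[OF True] \<open>K \<ge> 0\<close> by (intro add_increasing2) auto
  next
    case False
    then have "\<delta>\<^sup>2 \<le> \<bar>s\<bar>\<^sup>2" using \<delta>(1) by (intro power_mono) auto
    then have "B * 1 \<le> B * (s\<^sup>2 / \<delta>\<^sup>2)"
      using \<delta>(1) \<open>0 \<le> B\<close> by (intro mult_left_mono) simp_all
    then have "B \<le> K * s\<^sup>2" by (simp add: K_def)
    then show ?thesis using B[OF that] \<epsilon> by simp
  qed
  have bd: "dist (complex_of_real ((real m + 1) / 2) * (LINT s|lborel. complex_of_real (bump m s) * \<psi> s)) (\<psi> 0)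
      \<le> \<epsilon> / 2 + K * (2 / ((real m + 2) * (real m + 3)))" for m
  proof -
    let ?w = "(real m + 1) / 2"
    have w: "?w * (2 / (real m + 1)) = 1" "?w > 0" by (simp_all add: field_simps add_pos_nonneg)
    have split: "complex_of_real (bump m s) * \<psi> s
        = complex_of_real (bump m s) * ?d s + complex_of_real (bump m s) * \<psi> 0" for s
      by (simp add: algebra_simps)
    have "(LINT s|lborel. complex_of_real (bump m s) * \<psi> s)
        = (LINT s|lborel. complex_of_real (bump m s) * ?d s) + complex_of_real (2 / (real m + 1)) * \<psi> 0"
      unfolding split
      by (subst Bochner_Integration.integral_add)
        (use integrable_bump_mult[OF contd] integrable_bump_mult[OF continuous_on_const] in
          \<open>simp_all add: integral_bump\<close>)
    then have "complex_of_real ?w * (LINT s|lborel. complex_of_real (bump m s) * \<psi> s) - \<psi> 0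
        = ?w * (LINT s|lborel. complex_of_real (bump m s) * ?d s)
          + (complex_of_real (?w * (2 / (real m + 1))) * \<psi> 0 - \<psi> 0)"
      by (simp only: of_real_mult distrib_left mult.assoc add_diff_eq)
    also have "\<dots> = ?w * (LINT s|lborel. complex_of_real (bump m s) * ?d s)"
      unfolding w by simp
    finally have "dist (complex_of_real ?w * (LINT s|lborel. complex_of_real (bump m s) * \<psi> s)) (\<psi> 0)
        = ?w * cmod (LINT s|lborel. complex_of_real (bump m s) * ?d s)"
      using w(2) unfolding dist_norm by (simp only: norm_mult norm_of_real abs_of_pos)
    also have "cmod (LINT s|lborel. complex_of_real (bump m s) * ?d s)
        \<le> (LINT s|lborel. cmod (complex_of_real (bump m s) * ?d s))"
      by (rule integral_norm_bound)
    also have "\<dots> \<le> (LINT s|lborel. \<epsilon> / 2 * bump m s + K * (s\<^sup>2 * bump m s))"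
    proof (rule integral_mono)
      show "integrable lborel (\<lambda>s. cmod (complex_of_real (bump m s) * ?d s))"
        by (intro integrable_norm integrable_bump_mult contd)
      show "integrable lborel (\<lambda>s. \<epsilon> / 2 * bump m s + K * (s\<^sup>2 * bump m s))"
        using has_bochner_integral_square_bump[of m] by (simp add: has_bochner_integral_iff)
      show "cmod (complex_of_real (bump m s) * ?d s) \<le> \<epsilon> / 2 * bump m s + K * (s\<^sup>2 * bump m s)" for s
      proof (cases "s \<in> {-1..1}")
        case True
        show ?thesis using mult_left_mono[OF d[OF True] bump_nonneg[of m s]]
          unfolding norm_mult norm_of_real abs_of_nonneg[OF bump_nonneg] by (simp add: distrib_left mult_ac)
      qed (auto simp: bump_def)
    qed
    also have "\<dots> = \<epsilon> / 2 * (2 / (real m + 1)) + K * (4 / ((real m + 1) * (real m + 2) * (real m + 3)))"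
      by (intro has_bochner_integral_integral_eq has_bochner_integral_add has_bochner_integral_mult_right
          has_bochner_integral_bump has_bochner_integral_square_bump)
    finally have "dist (complex_of_real ?w * (LINT s|lborel. complex_of_real (bump m s) * \<psi> s)) (\<psi> 0)
        \<le> ?w * (\<epsilon> / 2 * (2 / (real m + 1)) + K * (4 / ((real m + 1) * (real m + 2) * (real m + 3))))"
      using w(2) by (simp add: mult_left_mono)
    also have "\<dots> = \<epsilon> / 2 + K * (2 / ((real m + 2) * (real m + 3)))"
    proof -
      have "real m + 1 \<noteq> 0" "real m + 2 \<noteq> 0" "real m + 3 \<noteq> 0" by linarith+
      then show ?thesis by (simp add: divide_simps)
    qed
    finally show ?thesis .
  qed
  have "(\<lambda>m. \<epsilon> / 2 + K * (2 / ((real m + 2) * (real m + 3)))) \<longlonglongrightarrow> \<epsilon> / 2"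
    by real_asymp
  then have "\<forall>\<^sub>F m in sequentially. \<epsilon> / 2 + K * (2 / ((real m + 2) * (real m + 3))) < \<epsilon>"
    by (rule order_tendstoD(2)) (use \<epsilon> in simp)
  then show "\<forall>\<^sub>F m in sequentially.
      dist (complex_of_real ((real m + 1) / 2) * (LINT s|lborel. complex_of_real (bump m s) * \<psi> s)) (\<psi> 0) < \<epsilon>"
    by eventually_elim (rule order_le_less_trans[OF bd])
qed

lemma integral_mod_bump:
  assumes "t > 0"
  shows "(LINT x|lborel. mod_bump c t u \<eta> n x * \<phi> x)
    = complex_of_real (t * c) * (LINT s|lborel. complex_of_real (bump n s) * (cis (\<eta> * (u + t * s)) * \<phi> (u + t * s)))"
proof -
  have "(LINT x|lborel. mod_bump c t u \<eta> n x * \<phi> x)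
      = (LINT x|lborel. (\<lambda>s. c * (complex_of_real (bump n s) * (cis (\<eta> * (u + t * s)) * \<phi> (u + t * s)))) ((x - u) / t))"
    using assms by (simp add: mod_bump_def mult_ac)
  also have "\<dots> = t *\<^sub>R (LINT s|lborel. c * (complex_of_real (bump n s) * (cis (\<eta> * (u + t * s)) * \<phi> (u + t * s))))"
    by (rule integral_rescale[OF assms])
  finally show ?thesis by (simp add: scaleR_conv_of_real)
qed

lemma mod_bump_normalised_tends_to_dirac:
  assumes t: "t > 0" and c: "\<And>n. c n \<noteq> 0"
  shows "tends_to_dirac (\<lambda>n x. mod_bump (c n) t u \<eta> n x / (LINT y|lborel. mod_bump (c n) t u \<eta> n y)) u"
  unfolding tends_to_dirac_def
proof (intro allI impI)
  fix \<phi> :: "real \<Rightarrow> complex" assume \<phi>: "continuous_on UNIV \<phi>"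
  let ?J = "\<lambda>n g. LINT s|lborel. complex_of_real (bump n s) * (cis (\<eta> * (u + t * s)) * g (u + t * s))"
  have lim: "(\<lambda>n. complex_of_real ((real n + 1) / 2) * ?J n g) \<longlonglongrightarrow> cis (\<eta> * u) * g u"
    if "continuous_on UNIV g" for g
  proof -
    have "continuous_on UNIV (\<lambda>s. cis (\<eta> * (u + t * s)) * g (u + t * s))"
      by (intro continuous_intros continuous_on_compose2[OF that]) simp
    from bump_approximate_identity[OF this] show ?thesis by simp
  qed
  have eq: "(LINT x|lborel. mod_bump (c n) t u \<eta> n x / (LINT y|lborel. mod_bump (c n) t u \<eta> n y) * \<phi> x)
      = complex_of_real ((real n + 1) / 2) * ?J n \<phi> / (complex_of_real ((real n + 1) / 2) * ?J n (\<lambda>_. 1))" for n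
  proof -
    have "(LINT x|lborel. mod_bump (c n) t u \<eta> n x / (LINT y|lborel. mod_bump (c n) t u \<eta> n y) * \<phi> x)
        = (LINT x|lborel. mod_bump (c n) t u \<eta> n x * \<phi> x) / (LINT y|lborel. mod_bump (c n) t u \<eta> n y * 1)"
      by (simp flip: integral_divide_zero)
    also have "\<dots> = ?J n \<phi> / ?J n (\<lambda>_. 1)"
      unfolding integral_mod_bump[OF t] using t c[of n] by simp
    also have "\<dots> = complex_of_real ((real n + 1) / 2) * ?J n \<phi> / (complex_of_real ((real n + 1) / 2) * ?J n (\<lambda>_. 1))"
    proof (rule mult_divide_mult_cancel_left[symmetric])
      have "(real n + 1) / 2 \<noteq> 0" by simp
      then show "complex_of_real ((real n + 1) / 2) \<noteq> 0" by (simp only: of_real_eq_0_iff not_False_eq_True)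
    qed
    finally show ?thesis .
  qed
  have "(\<lambda>n. complex_of_real ((real n + 1) / 2) * ?J n \<phi> / (complex_of_real ((real n + 1) / 2) * ?J n (\<lambda>_. 1)))
      \<longlonglongrightarrow> cis (\<eta> * u) * \<phi> u / (cis (\<eta> * u) * 1)"
    by (intro tendsto_divide lim \<phi> continuous_on_const) (simp add: cis_neq_zero)
  then show "(\<lambda>n. LINT x|lborel. mod_bump (c n) t u \<eta> n x / (LINT y|lborel. mod_bump (c n) t u \<eta> n y) * \<phi> x)
      \<longlonglongrightarrow> \<phi> u"
    unfolding eq by (simp add: cis_neq_zero)
qed

text \<open>The energy density of the atom of order \<open>n\<close> is again a bump, of order \<open>2 * n\<close>.\<close>
lemma mod_bump_square_tends_to_dirac:
  assumes t: "t > 0" and c: "\<And>n. (c n)\<^sup>2 = (2 * real n + 1) / (2 * t)"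
  shows "tends_to_dirac (\<lambda>n x. complex_of_real ((cmod (mod_bump (c n) t u \<eta> n x))\<^sup>2)) u"
  unfolding tends_to_dirac_def
proof (intro allI impI)
  fix \<phi> :: "real \<Rightarrow> complex" assume \<phi>: "continuous_on UNIV \<phi>"
  have "continuous_on UNIV (\<lambda>s. \<phi> (u + t * s))"
    by (intro continuous_on_compose2[OF \<phi>] continuous_intros) simp
  from bump_approximate_identity[OF this]
  have lim: "(\<lambda>m. complex_of_real ((real m + 1) / 2) * (LINT s|lborel. complex_of_real (bump m s) * \<phi> (u + t * s))) \<longlonglongrightarrow> \<phi> u"
    by simp
  have "filterlim (\<lambda>n::nat. 2 * n) sequentially sequentially"
    by (intro filterlim_subseq strict_monoI) simp
  note lim2 = filterlim_compose[OF lim this]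
  have "(LINT x|lborel. complex_of_real ((cmod (mod_bump (c n) t u \<eta> n x))\<^sup>2) * \<phi> x)
      = complex_of_real ((real (2 * n) + 1) / 2) * (LINT s|lborel. complex_of_real (bump (2 * n) s) * \<phi> (u + t * s))" for n
  proof -
    have "(LINT x|lborel. complex_of_real ((cmod (mod_bump (c n) t u \<eta> n x))\<^sup>2) * \<phi> x)
      = (LINT x|lborel. mod_bump ((c n)\<^sup>2) t u 0 (2 * n) x * \<phi> x)"
      unfolding norm_mod_bump by (simp add: mod_bump_def)
    also have "\<dots> = complex_of_real (t * (c n)\<^sup>2) * (LINT s|lborel. complex_of_real (bump (2 * n) s) * \<phi> (u + t * s))"
      unfolding integral_mod_bump[OF t] by simp
    also have "t * (c n)\<^sup>2 = (real (2 * n) + 1) / 2" using t by (simp add: c)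
    finally show ?thesis .
  qed
  then show "(\<lambda>n. LINT x|lborel. complex_of_real ((cmod (mod_bump (c n) t u \<eta> n x))\<^sup>2) * \<phi> x) \<longlonglongrightarrow> \<phi> u"
    using lim2 by (simp only:)
qed

section \<open>The uncertainty over the dictionary\<close>

lemma atom_eq_mod_bump:
  "atom (t, \<xi>, u) n = mod_bump (sqrt ((2 * real n + 1) / (2 * t))) t u (2 * pi * \<xi>) n"
  by (simp add: atom_def profile_def mod_bump_def bump_def fun_eq_iff mult.assoc)

lemma uncertainty_atom:
  assumes "\<gamma> \<in> Gam"
  shows "uncertainty (atom \<gamma> n) = (if n = 0 then \<infinity> else ennreal (U_bump n))"
proof -
  obtain t \<xi> u where \<gamma>: "\<gamma> = (t, \<xi>, u)" "t > 0" using assms by (auto simp: Gam_def)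
  then have "sqrt ((2 * real n + 1) / (2 * t)) \<noteq> 0" by (simp add: add_nonneg_eq_0_iff)
  then show ?thesis unfolding \<gamma>(1) atom_eq_mod_bump by (rule uncertainty_mod_bump[OF \<gamma>(2)])
qed

lemma uncertainty_atom_ge:
  assumes "\<gamma> \<in> Gam"
  shows "ennreal (3 / 10) \<le> uncertainty (atom \<gamma> n)"
    and "uncertainty (atom \<gamma> n) \<le> ennreal (3 / 10) \<Longrightarrow> n = 1"
proof -
  consider "n = 0" | "n = 1" | "n \<ge> 2" by linarith
  then have "ennreal (3 / 10) \<le> uncertainty (atom \<gamma> n) \<and> (uncertainty (atom \<gamma> n) \<le> ennreal (3 / 10) \<longrightarrow> n = 1)"
  proof cases
    case 3
    then have "ennreal (3 / 10) < ennreal (U_bump n)" using U_bump_greater[OF 3] by (intro ennreal_lessI) auto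
    moreover have "uncertainty (atom \<gamma> n) = ennreal (U_bump n)"
      using 3 by (simp add: uncertainty_atom[OF assms])
    ultimately show ?thesis by (simp only: less_imp_le not_le[symmetric] simp_thms)
  qed (use U_bump_1 in \<open>simp_all add: uncertainty_atom[OF assms] top_unique\<close>)
  then show "ennreal (3 / 10) \<le> uncertainty (atom \<gamma> n)"
    and "uncertainty (atom \<gamma> n) \<le> ennreal (3 / 10) \<Longrightarrow> n = 1" by auto
qed

lemma uncertainty_atom_le:
  assumes "\<gamma> \<in> Gam" "n \<noteq> 0"
  shows "uncertainty (atom \<gamma> n) \<le> ennreal (1 / 2)"
proof -
  have "ennreal (U_bump n) \<le> ennreal (1 / 2)"
    using U_bump_less_half[of n] assms(2) by (intro ennreal_leI) simp
  moreover have "uncertainty (atom \<gamma> n) = ennreal (U_bump n)"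
    using assms by (simp add: uncertainty_atom)
  ultimately show ?thesis by (simp only:)
qed

lemma uncertainty_atom_tendsto:
  assumes "\<gamma> \<in> Gam"
  shows "(\<lambda>n. uncertainty (atom \<gamma> n)) \<longlonglongrightarrow> ennreal (1 / 2)"
proof (rule LIMSEQ_offset[of _ 1])
  show "(\<lambda>n. uncertainty (atom \<gamma> (n + 1))) \<longlonglongrightarrow> ennreal (1 / 2)"
    using tendsto_ennrealI[OF LIMSEQ_ignore_initial_segment[OF U_bump_lim, of 1]]
    by (simp add: uncertainty_atom[OF assms])
qed

theorem theorem2p2:
  shows "(INF f\<in>dictionary. uncertainty f) = ennreal (3 / 10)
    \<and> (\<forall>\<gamma>\<in>Gam. uncertainty (atom \<gamma> 1) = ennreal (3 / 10))
    \<and> {f. is_arg_min uncertainty (\<lambda>f. f \<in> dictionary) f} = {atom \<gamma> 1 | \<gamma>. \<gamma> \<in> Gam}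
    \<and> (\<forall>t>0. uncertainty (\<lambda>x. complex_of_real
          (sqrt (3 / (2 * t)) * (1 - \<bar>x\<bar>) * indicator {-1..1} x)) = ennreal (3 / 10))
    \<and> (\<forall>\<gamma>\<in>Gam. \<forall>n. uncertainty (atom \<gamma> n) = \<infinity> \<longleftrightarrow> n = 0)
    \<and> (SUP f\<in>{f \<in> dictionary. uncertainty f < \<infinity>}. uncertainty f) = ennreal (1 / 2)
    \<and> (\<forall>t \<xi> u. (t, \<xi>, u) \<in> Gam \<longrightarrow>
          (\<lambda>n. uncertainty (atom (t, \<xi>, u) n)) \<longlonglongrightarrow> ennreal (1 / 2)
        \<and> tends_to_dirac (\<lambda>n x. atom (t, \<xi>, u) n x / (LINT y|lborel. atom (t, \<xi>, u) n y)) u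
        \<and> tends_to_dirac (\<lambda>n x. complex_of_real ((cmod (atom (t, \<xi>, u) n x))\<^sup>2)) u)"
proof (intro conjI allI ballI impI)
  have \<gamma>0: "(1, 0, 0) \<in> Gam" by (simp add: Gam_def)
  have one: "uncertainty (atom \<gamma> 1) = ennreal (3 / 10)" if "\<gamma> \<in> Gam" for \<gamma>
    using U_bump_1 by (simp add: uncertainty_atom[OF that])
  have mem: "atom \<gamma> n \<in> dictionary" if "\<gamma> \<in> Gam" for \<gamma> n
    using that unfolding dictionary_def by blast
  have ge: "ennreal (3 / 10) \<le> uncertainty f" if "f \<in> dictionary" for f
    using that uncertainty_atom_ge(1) unfolding dictionary_def by blast
  show "uncertainty (atom \<gamma> 1) = ennreal (3 / 10)" if "\<gamma> \<in> Gam" for \<gamma>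
    by (rule one[OF that])
  show "(INF f\<in>dictionary. uncertainty f) = ennreal (3 / 10)"
    by (intro antisym INF_greatest ge INF_lower2[OF mem[OF \<gamma>0, of 1]]) (simp_all only: one[OF \<gamma>0])
  show "{f. is_arg_min uncertainty (\<lambda>f. f \<in> dictionary) f} = {atom \<gamma> 1 | \<gamma>. \<gamma> \<in> Gam}"
  proof (intro equalityI subsetI)
    fix f assume "f \<in> {f. is_arg_min uncertainty (\<lambda>f. f \<in> dictionary) f}"
    then have f: "f \<in> dictionary" "\<And>g. g \<in> dictionary \<Longrightarrow> uncertainty f \<le> uncertainty g"
      by (auto simp: is_arg_min_def not_less)
    then obtain \<gamma> n where \<gamma>: "f = atom \<gamma> n" "\<gamma> \<in> Gam" unfolding dictionary_def by blast
    have "n = 1"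
      using uncertainty_atom_ge(2)[OF \<gamma>(2), of n] f(2)[OF mem[OF \<gamma>(2), of 1]]
      by (simp only: one[OF \<gamma>(2)] \<gamma>(1))
    then show "f \<in> {atom \<gamma> 1 | \<gamma>. \<gamma> \<in> Gam}" using \<gamma> by blast
  next
    fix f assume "f \<in> {atom \<gamma> 1 | \<gamma>. \<gamma> \<in> Gam}"
    then show "f \<in> {f. is_arg_min uncertainty (\<lambda>f. f \<in> dictionary) f}"
      using one mem ge by (auto simp: is_arg_min_def not_less simp del: One_nat_def)
  qed
  show "uncertainty (\<lambda>x. complex_of_real (sqrt (3 / (2 * t)) * (1 - \<bar>x\<bar>) * indicator {-1..1} x))
      = ennreal (3 / 10)" if "t > 0" for t
  proof -
    have "(\<lambda>x. complex_of_real (sqrt (3 / (2 * t)) * (1 - \<bar>x\<bar>) * indicator {-1..1} x))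
        = mod_bump (sqrt (3 / (2 * t))) 1 0 0 1"
      by (simp add: mod_bump_def bump_def fun_eq_iff mult.assoc)
    then show ?thesis using that U_bump_1 by (simp add: uncertainty_mod_bump)
  qed
  show "uncertainty (atom \<gamma> n) = \<infinity> \<longleftrightarrow> n = 0" if "\<gamma> \<in> Gam" for \<gamma> n
    by (simp add: uncertainty_atom[OF that])
  show "(SUP f\<in>{f \<in> dictionary. uncertainty f < \<infinity>}. uncertainty f) = ennreal (1 / 2)"
  proof (rule antisym)
    show "(SUP f\<in>{f \<in> dictionary. uncertainty f < \<infinity>}. uncertainty f) \<le> ennreal (1 / 2)"
    proof (rule SUP_least)
      fix f assume f: "f \<in> {f \<in> dictionary. uncertainty f < \<infinity>}"
      then obtain \<gamma> n where \<gamma>: "f = atom \<gamma> n" "\<gamma> \<in> Gam" unfolding dictionary_def by blast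
      have "n \<noteq> 0"
      proof
        assume "n = 0"
        then show False using f \<gamma> by (simp add: uncertainty_atom)
      qed
      then show "uncertainty f \<le> ennreal (1 / 2)"
        unfolding \<gamma>(1) by (rule uncertainty_atom_le[OF \<gamma>(2)])
    qed
    show "ennreal (1 / 2) \<le> (SUP f\<in>{f \<in> dictionary. uncertainty f < \<infinity>}. uncertainty f)"
    proof (rule LIMSEQ_le_const2[OF uncertainty_atom_tendsto[OF \<gamma>0]], intro exI allI impI)
      fix n :: nat assume "1 \<le> n"
      then show "uncertainty (atom (1, 0, 0) n) \<le> (SUP f\<in>{f \<in> dictionary. uncertainty f < \<infinity>}. uncertainty f)"
        using mem[OF \<gamma>0] by (intro SUP_upper) (simp add: uncertainty_atom[OF \<gamma>0])
    qed
  qed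
next
  fix t \<xi> u :: real assume \<gamma>: "(t, \<xi>, u) \<in> Gam"
  then have t: "t > 0" by (simp add: Gam_def)
  show "(\<lambda>n. uncertainty (atom (t, \<xi>, u) n)) \<longlonglongrightarrow> ennreal (1 / 2)"
    by (rule uncertainty_atom_tendsto[OF \<gamma>])
  show "tends_to_dirac (\<lambda>n x. atom (t, \<xi>, u) n x / (LINT y|lborel. atom (t, \<xi>, u) n y)) u"
    unfolding atom_eq_mod_bump
    by (rule mod_bump_normalised_tends_to_dirac[OF t]) (use t in \<open>simp add: add_nonneg_eq_0_iff\<close>)
  show "tends_to_dirac (\<lambda>n x. complex_of_real ((cmod (atom (t, \<xi>, u) n x))\<^sup>2)) u"
    unfolding atom_eq_mod_bump
    by (rule mod_bump_square_tends_to_dirac[OF t]) (use t in simp)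
qed

end
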